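(* Let $c_0,c_h\in\mathbb{R}$ be constants and let $(T,\mathbf{J},\boldsymbol{\psi},\varphi)$ be a smooth solution on $\Omega\times[0,t_f]$ of $$\partial_t T+c_0\nabla\cdot\mathbf{J}=0,\qquad \partial_t\mathbf{J}+c_0\nabla T+c_h\nabla\times\boldsymbol{\psi}=-\tfrac1\tau\mathbf{J},$$ $$\partial_t\boldsymbol{\psi}-c_h\nabla\times\mathbf{J}+c_h\nabla\varphi=0,\qquad \partial_t\varphi+c_h\nabla\cdot\boldsymbol{\psi}=0,$$ with boundary conditions such that the boundary terms vanish, i.e. $\int_{\partial\Omega}c_0(\nabla\cdot\mathbf{J})\,\nabla T\cdot\mathbf{n}\,\mathrm{d}S=0$ and $\int_{\partial\Omega}c_h(\nabla\cdot\boldsymbol{\psi})\,\nabla\varphi\cdot\mathbf{n}\,\mathrm{d}S=0$ for all $t$. Define $$\mathrm{E}_T=\int_\Omega\tfrac12\big(\|\nabla T\|^2+(\nabla\cdot\mathbf{J})^2\big)\,\mathrm{d}\Omega,\qquad \mathrm{E}_\varphi=\int_\Omega\tfrac12\big(\|\nabla\varphi\|^2+(\nabla\cdot\boldsymbol{\psi})^2\big)\,\mathrm{d}\Omega.$$ Then $$\mathrm{E}_T(t)-\mathrm{E}_T(0)=-\frac1\tau\int_0^t\int_\Omega(\nabla\cdot\mathbf{J}(\mathbf{x},s))^2\,\mathrm{d}\Omega\,\mathrm{d}s\le0,\qquad \mathrm{E}_\varphi(t)-\mathrm{E}_\varphi(0)=0.$$ In particular: (a) for finite $\tau>0$, $\mathrm{E}_T$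 is non-increasing and $\mathrm{E}_\varphi$ is conserved; (b) in the absence of relaxation ($1/\tau=0$), both $\mathrm{E}_T$ and $\mathrm{E}_\varphi$ are conserved. As a consequence, in both cases: if $\nabla T(\mathbf{x},0)=0$ and $\nabla\cdot\mathbf{J}(\mathbf{x},0)=0$, then $\nabla T(\mathbf{x},t)=0$ and $\nabla\cdot\mathbf{J}(\mathbf{x},t)=0$ for all $t>0$; and if $\nabla\varphi(\mathbf{x},0)=0$ and $\nabla\cdot\boldsymbol{\psi}(\mathbf{x},0)=0$, then $\nabla\varphi(\mathbf{x},t)=0$ and $\nabla\cdot\boldsymbol{\psi}(\mathbf{x},t)=0$ for all $t>0$.
   Context: $\Omega\subset\mathbb{R}^3$ is a bounded domain on which the divergence theorem holds, with unit outward normal $\mathbf{n}$; $t_f>0$ and times $t$ range over the interval of existence $[0,t_f]$. The unknowns are $T,\varphi\in\mathbb{R}$ and $\mathbf{J},\boldsymbol{\psi}\in\mathbb{R}^3$, functions of $(\mathbf{x},t)$. The relaxation time is a constant $\tau\in(0,+\infty]$, with the convention that $1/\tau=0$ (i.e. $\tau=+\infty$) means the relaxation source term is absent. $\|\cdot\|$ is the Euclidean norm. *)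

theory Defs
  imports "HOL-Analysis.Analysis"
begin

section \<open>Differential operators\<close>

text \<open>Entry \<open>(i, j)\<close> of \<^term>\<open>jacobian F (at x)\<close> is the partial derivative of \<open>F\<^sub>i\<close> in
  direction \<open>j\<close>.  Time is the first argument of a field, so that \<open>u t\<close> is the spatial
  profile at time \<open>t\<close>.\<close>

definition grad :: "(real^3 \<Rightarrow> real) \<Rightarrow> real^3 \<Rightarrow> real^3" where
  "grad f x = (\<chi> i. frechet_derivative f (at x) (axis i 1))"

definition divergence :: "(real^3 \<Rightarrow> real^3) \<Rightarrow> real^3 \<Rightarrow> real" where
  "divergence F x = trace (jacobian F (at x))"

definition curl :: "(real^3 \<Rightarrow> real^3) \<Rightarrow> real^3 \<Rightarrow> real^3" where
  "curl F x = (let D = jacobian F (at x) in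
     vector [D$3$2 - D$2$3, D$1$3 - D$3$1, D$2$1 - D$1$2])"

definition time_deriv :: "(real \<Rightarrow> 'a \<Rightarrow> 'b::real_normed_vector) \<Rightarrow> real \<Rightarrow> 'a \<Rightarrow> 'b" where
  "time_deriv u t x = vector_derivative (\<lambda>s. u s x) (at t)"


section \<open>Smoothness\<close>

text \<open>Meant for open \<open>S\<close>.\<close>

primrec C_on :: "nat \<Rightarrow> 'a::real_normed_vector set \<Rightarrow> ('a \<Rightarrow> 'b::real_normed_vector) \<Rightarrow> bool" where
  "C_on 0 S f \<longleftrightarrow> continuous_on S f"
| "C_on (Suc k) S f \<longleftrightarrow>
     (\<forall>x\<in>S. f differentiable (at x)) \<and> (\<forall>v. C_on k S (\<lambda>x. frechet_derivative f (at x) v))"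

text \<open>Smooth up to the boundary of \<open>{0..t\<^sub>f} \<times> \<Omega>\<close>, i.e.\ \<open>C\<^sup>\<infinity>\<close> on a neighbourhood of its closure.
  The values of the derivatives on \<open>\<partial>\<Omega>\<close> and at the two end times are limits
  of those inside, so they do not depend on how the field is continued outside.\<close>

definition smooth_field ::
    "real \<Rightarrow> (real^3) set \<Rightarrow> (real \<Rightarrow> real^3 \<Rightarrow> 'b::real_normed_vector) \<Rightarrow> bool" where
  "smooth_field t\<^sub>f \<Omega> u \<longleftrightarrow>
     (\<exists>U. open U \<and> {0..t\<^sub>f} \<times> closure \<Omega> \<subseteq> U \<and> (\<forall>k. C_on k U (\<lambda>(t, x). u t x)))"


section \<open>Surface measure\<close>

text \<open>Two-dimensional Hausdorff measure, normalised by \<open>\<pi>/4\<close> so that it agrees with surface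
  area.  The boundedness condition is there because \<^term>\<open>diameter\<close> is unspecified on
  unbounded sets.\<close>

definition hausdorff2_pre :: "real \<Rightarrow> 'a::metric_space set \<Rightarrow> ennreal" where
  "hausdorff2_pre \<delta> A =
     (INF C\<in>{C :: nat \<Rightarrow> 'a set. A \<subseteq> (\<Union>i. C i) \<and> (\<forall>i. bounded (C i) \<and> diameter (C i) \<le> \<delta>)}.
        \<Sum>i. ennreal (pi / 4 * (diameter (C i))\<^sup>2))"

definition hausdorff2_outer :: "'a::metric_space set \<Rightarrow> ennreal" where
  "hausdorff2_outer A = (SUP \<delta>\<in>{0<..}. hausdorff2_pre \<delta> A)"

definition surface_measure :: "(real^3) measure" where
  "surface_measure = measure_of UNIV (sets borel) hausdorff2_outer"

text \<open>\<^const>\<open>measure_of\<close> yields the zero measure unless the given set function is countably additive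
  on the given sets, so this has to be checked; it is Caratheodory's criterion for metric outer
  measures.\<close>

lemma ennreal_add_strict:
  fixes x :: ennreal
  assumes "x < top" "0 < e"
  shows "x < x + e"
  using ennreal_add_left_cancel_less[of x 0 e] assms by (auto simp: less_top)

lemma hausdorff2_pre_le:
  assumes "A \<subseteq> (\<Union>i. C i)" "\<And>i::nat. bounded (C i)" "\<And>i. diameter (C i) \<le> \<delta>"
  shows "hausdorff2_pre \<delta> A \<le> (\<Sum>i. ennreal (pi / 4 * (diameter (C i))\<^sup>2))"
  unfolding hausdorff2_pre_def using assms by (intro INF_lower) auto

lemma hausdorff2_pre_greatest:
  assumes "\<And>C :: nat \<Rightarrow> 'a::metric_space set. A \<subseteq> (\<Union>i. C i) \<Longrightarrow> (\<And>i. bounded (C i)) \<Longrightarrow>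
     (\<And>i. diameter (C i) \<le> \<delta>) \<Longrightarrow> x \<le> (\<Sum>i. ennreal (pi / 4 * (diameter (C i))\<^sup>2))"
  shows "x \<le> hausdorff2_pre \<delta> A"
  unfolding hausdorff2_pre_def using assms by (intro INF_greatest) auto

lemma hausdorff2_pre_mono: "A \<subseteq> B \<Longrightarrow> \<delta> \<le> \<delta>' \<Longrightarrow> hausdorff2_pre \<delta>' A \<le> hausdorff2_pre \<delta> B"
  unfolding hausdorff2_pre_def by (intro INF_superset_mono) (auto intro: order_trans)

lemma hausdorff2_outer_mono: "A \<subseteq> B \<Longrightarrow> hausdorff2_outer A \<le> hausdorff2_outer B"
  unfolding hausdorff2_outer_def by (intro SUP_mono) (auto intro: hausdorff2_pre_mono)

lemma hausdorff2_outer_upper: "\<delta> > 0 \<Longrightarrow> hausdorff2_pre \<delta> A \<le> hausdorff2_outer A"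
  unfolding hausdorff2_outer_def by (intro SUP_upper) auto

lemma hausdorff2_outer_empty [simp]: "hausdorff2_outer {} = 0"
proof -
  have "hausdorff2_pre \<delta> {} \<le> 0" if "\<delta> > 0" for \<delta>
    using hausdorff2_pre_le[of "{}" "\<lambda>_. {}" \<delta>] that by simp
  then show ?thesis
    unfolding hausdorff2_outer_def by (intro antisym SUP_least) auto
qed

lemma hausdorff2_pre_UN_le: "hausdorff2_pre \<delta> (\<Union>i::nat. A i) \<le> (\<Sum>i. hausdorff2_pre \<delta> (A i))"
proof (rule ennreal_le_epsilon)
  fix e :: real
  assume fin: "(\<Sum>i. hausdorff2_pre \<delta> (A i)) < top" and e: "0 < e"
  define f :: "'a set \<Rightarrow> ennreal" where "f = (\<lambda>C. ennreal (pi / 4 * (diameter C)\<^sup>2))"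
  have "\<exists>C. A i \<subseteq> (\<Union>j::nat. C j) \<and> (\<forall>j. bounded (C j) \<and> diameter (C j) \<le> \<delta>) \<and>
          (\<Sum>j. f (C j)) \<le> hausdorff2_pre \<delta> (A i) + ennreal (e * (1/2) ^ Suc i)" for i
  proof -
    have "hausdorff2_pre \<delta> (A i) < top"
      using ennreal_suminf_lessD[OF fin] .
    then have "hausdorff2_pre \<delta> (A i) < hausdorff2_pre \<delta> (A i) + ennreal (e * (1/2) ^ Suc i)"
      by (intro ennreal_add_strict) (use e in auto)
    then show ?thesis
      unfolding hausdorff2_pre_def[of \<delta> "A i"] INF_less_iff f_def by (force intro: less_imp_le)
  qed
  then obtain C where C: "\<And>i. A i \<subseteq> (\<Union>j::nat. C i j)" "\<And>i j. bounded (C i j)"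
      "\<And>i j. diameter (C i j) \<le> \<delta>"
      "\<And>i. (\<Sum>j. f (C i j)) \<le> hausdorff2_pre \<delta> (A i) + ennreal (e * (1/2) ^ Suc i)"
    by metis
  have "(\<Union>i. A i) \<subseteq> (\<Union>k. case_prod C (prod_decode k))"
  proof
    fix x assume "x \<in> (\<Union>i. A i)"
    then obtain i j where "x \<in> C i j" using C(1) by blast
    then show "x \<in> (\<Union>k. case_prod C (prod_decode k))"
      by (intro UN_I[of "prod_encode (i, j)"]) auto
  qed
  then have "hausdorff2_pre \<delta> (\<Union>i. A i) \<le> (\<Sum>k. f (case_prod C (prod_decode k)))"
    unfolding f_def using C by (intro hausdorff2_pre_le) (auto split: prod.split)
  also have "\<dots> = (\<Sum>i. \<Sum>j. f (C i j))"
    using suminf_ennreal_2dimen[of "\<lambda>i. \<Sum>j. f (C i j)" "\<lambda>p. f (case_prod C p)"] by simp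
  also have "\<dots> \<le> (\<Sum>i. hausdorff2_pre \<delta> (A i) + ennreal (e * (1/2) ^ Suc i))"
    using C(4) by (intro suminf_le) auto
  also have "\<dots> = (\<Sum>i. hausdorff2_pre \<delta> (A i)) + (\<Sum>i. ennreal e * ennreal ((1/2) ^ Suc i))"
    using e by (subst suminf_add[symmetric]) (auto simp: ennreal_mult' simp del: power_Suc)
  also have "(\<Sum>i. ennreal e * ennreal ((1/2) ^ Suc i)) = ennreal e"
    unfolding ennreal_suminf_cmult
    by (subst suminf_ennreal_eq[OF zero_le_power power_half_series]) auto
  finally show "hausdorff2_pre \<delta> (\<Union>i. A i) \<le> (\<Sum>i. hausdorff2_pre \<delta> (A i)) + ennreal e" .
qed

lemma hausdorff2_outer_UN_le: "hausdorff2_outer (\<Union>i::nat. A i) \<le> (\<Sum>i. hausdorff2_outer (A i))"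
  unfolding hausdorff2_outer_def[of "\<Union>i. A i"]
proof (rule SUP_least)
  fix \<delta> :: real assume "\<delta> \<in> {0<..}"
  have "hausdorff2_pre \<delta> (\<Union>i. A i) \<le> (\<Sum>i. hausdorff2_pre \<delta> (A i))"
    by (rule hausdorff2_pre_UN_le)
  also have "\<dots> \<le> (\<Sum>i. hausdorff2_outer (A i))"
    using \<open>\<delta> \<in> {0<..}\<close> by (intro suminf_le) (auto intro: hausdorff2_outer_upper)
  finally show "hausdorff2_pre \<delta> (\<Union>i. A i) \<le> (\<Sum>i. hausdorff2_outer (A i))" .
qed

lemma hausdorff2_outer_Un_le: "hausdorff2_outer (A \<union> B) \<le> hausdorff2_outer A + hausdorff2_outer B"
proof -
  have "hausdorff2_outer (\<Union>i. binaryset A B i) \<le> (\<Sum>i. hausdorff2_outer (binaryset A B i))"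
    by (rule hausdorff2_outer_UN_le)
  also have "\<dots> = hausdorff2_outer A + hausdorff2_outer B"
    by (rule suminf_binaryset_eq) simp
  finally show ?thesis by (simp add: UN_binaryset_eq)
qed

lemma hausdorff2_outer_separated:
  assumes d: "d > 0" and sep: "\<And>x y. x \<in> A \<Longrightarrow> y \<in> B \<Longrightarrow> d \<le> dist x y"
  shows "hausdorff2_outer A + hausdorff2_outer B \<le> hausdorff2_outer (A \<union> B)"
proof -
  have small: "hausdorff2_pre \<delta> A + hausdorff2_pre \<delta> B \<le> hausdorff2_pre \<delta> (A \<union> B)"
    if "0 < \<delta>" "\<delta> < d" for \<delta>
  proof (rule hausdorff2_pre_greatest)
    fix C :: "nat \<Rightarrow> 'a set"
    assume C: "A \<union> B \<subseteq> (\<Union>i. C i)" "\<And>i. bounded (C i)" "\<And>i. diameter (C i) \<le> \<delta>"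
    define f :: "'a set \<Rightarrow> ennreal" where "f = (\<lambda>C. ennreal (pi / 4 * (diameter C)\<^sup>2))"
    define P Q where "P = (\<lambda>i. if C i \<inter> A \<noteq> {} then C i else {})"
      and "Q = (\<lambda>i. if C i \<inter> B \<noteq> {} then C i else {})"
    have "hausdorff2_pre \<delta> A \<le> (\<Sum>i. f (P i))" "hausdorff2_pre \<delta> B \<le> (\<Sum>i. f (Q i))"
      unfolding f_def using C that by (intro hausdorff2_pre_le; fastforce simp: P_def Q_def)+
    then have "hausdorff2_pre \<delta> A + hausdorff2_pre \<delta> B \<le> (\<Sum>i. f (P i)) + (\<Sum>i. f (Q i))"
      by (rule add_mono)
    also have "\<dots> = (\<Sum>i. f (P i) + f (Q i))"
      by (rule suminf_add) auto
    also have "\<dots> \<le> (\<Sum>i. f (C i))"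
    proof (rule suminf_le)
      fix i
      have "C i \<inter> A = {} \<or> C i \<inter> B = {}"
      proof (rule ccontr)
        assume "\<not> ?thesis"
        then obtain x y where "x \<in> C i" "x \<in> A" "y \<in> C i" "y \<in> B" by blast
        then have "d \<le> diameter (C i)"
          using sep diameter_bounded_bound[OF C(2)] by (meson order_trans)
        then show False using C(3)[of i] that by simp
      qed
      then show "f (P i) + f (Q i) \<le> f (C i)"
        by (auto simp: P_def Q_def f_def)
    qed auto
    finally show "hausdorff2_pre \<delta> A + hausdorff2_pre \<delta> B
      \<le> (\<Sum>i. ennreal (pi / 4 * (diameter (C i))\<^sup>2))" by (simp add: f_def)
  qed
  have "hausdorff2_pre \<delta> A + hausdorff2_pre \<delta>' B \<le> hausdorff2_outer (A \<union> B)"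
    if "0 < \<delta>" "0 < \<delta>'" for \<delta> \<delta>'
  proof -
    define \<eta> where "\<eta> = min (min \<delta> \<delta>') (d / 2)"
    have \<eta>: "0 < \<eta>" "\<eta> < d" "\<eta> \<le> \<delta>" "\<eta> \<le> \<delta>'" using that d by (auto simp: \<eta>_def)
    have "hausdorff2_pre \<delta> A + hausdorff2_pre \<delta>' B \<le> hausdorff2_pre \<eta> A + hausdorff2_pre \<eta> B"
      using \<eta> by (intro add_mono hausdorff2_pre_mono) auto
    also have "\<dots> \<le> hausdorff2_pre \<eta> (A \<union> B)" using \<eta> by (intro small)
    also have "\<dots> \<le> hausdorff2_outer (A \<union> B)" using \<eta> by (intro hausdorff2_outer_upper)
    finally show ?thesis .
  qed
  then have "hausdorff2_pre \<delta> A + hausdorff2_outer B \<le> hausdorff2_outer (A \<union> B)"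
    if "0 < \<delta>" for \<delta>
    unfolding hausdorff2_outer_def[of B] using that
    by (subst ennreal_SUP_add_right) (auto intro!: SUP_least)
  then show ?thesis
    unfolding hausdorff2_outer_def[of A]
    by (subst ennreal_SUP_add_left[symmetric]) (auto intro!: SUP_least)
qed

lemma hausdorff2_outer_separated_sum:
  assumes "\<And>j. \<exists>d>0. \<forall>x\<in>(\<Union>i<j. S i). \<forall>y\<in>S j. d \<le> dist x y"
  shows "(\<Sum>j<N. hausdorff2_outer (S j)) \<le> hausdorff2_outer (\<Union>j<N::nat. S j)"
proof (induction N)
  case (Suc N)
  obtain d where d: "d > 0" "\<And>x y. x \<in> (\<Union>i<N. S i) \<Longrightarrow> y \<in> S N \<Longrightarrow> d \<le> dist x y"
    using assms by meson
  have "(\<Sum>j<Suc N. hausdorff2_outer (S j))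
      \<le> hausdorff2_outer (\<Union>j<N. S j) + hausdorff2_outer (S N)"
    using Suc by (simp add: add_right_mono)
  also have "\<dots> \<le> hausdorff2_outer ((\<Union>j<N. S j) \<union> S N)"
    by (rule hausdorff2_outer_separated[OF d])
  also have "(\<Union>j<N. S j) \<union> S N = (\<Union>j<Suc N. S j)"
    by (simp add: lessThan_Suc Un_commute)
  finally show ?case .
qed simp

lemma hausdorff2_outer_closed_split:
  assumes C: "closed C" "C \<noteq> {}"
  shows "hausdorff2_outer (A \<inter> C) + hausdorff2_outer (A - C) \<le> hausdorff2_outer A"
proof (cases "hausdorff2_outer A = top")
  case False
  define \<mu> :: "'a set \<Rightarrow> ennreal" where "\<mu> = hausdorff2_outer"
  have fin: "\<mu> A < top" using False by (simp add: \<mu>_def less_top)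
  define P where "P n = {x \<in> A. 1 / real (n + 1) \<le> infdist x C}" for n :: nat
  define R where "R k = {x \<in> A. 1 / real (k + 2) \<le> infdist x C \<and> infdist x C < 1 / real (k + 1)}"
    for k :: nat
  have sep: "1 / real (m + 2) - 1 / real (k + 1) \<le> dist x y"
    if "1 / real (m + 2) \<le> infdist x C" "y \<in> R k" for x y m k
    using infdist_triangle[of x C y] that by (auto simp: R_def)
  have pos: "0 < 1 / real (m + 2) - 1 / real (k + 1)" if "m + 1 < k" for m k
    using that by (simp add: frac_less2)
  have half: "(\<Sum>j<N. \<mu> (R (2 * j + b))) \<le> \<mu> A" for N b
  proof -
    have "(\<Sum>j<N. \<mu> (R (2 * j + b))) \<le> \<mu> (\<Union>j<N. R (2 * j + b))"
      unfolding \<mu>_def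
    proof (rule hausdorff2_outer_separated_sum)
      fix j
      show "\<exists>d>0. \<forall>x\<in>(\<Union>i<j. R (2 * i + b)). \<forall>y\<in>R (2 * j + b). d \<le> dist x y"
      proof (cases j)
        case (Suc m)
        show ?thesis
        proof (intro exI conjI ballI)
          show "0 < 1 / real ((2 * m + b) + 2) - 1 / real ((2 * j + b) + 1)"
            by (rule pos) (simp add: Suc)
          fix x y assume x: "x \<in> (\<Union>i<j. R (2 * i + b))" and y: "y \<in> R (2 * j + b)"
          from x obtain i where "i < j" "x \<in> R (2 * i + b)" by auto
          then have "1 / real ((2 * m + b) + 2) \<le> 1 / real ((2 * i + b) + 2)"
              "1 / real ((2 * i + b) + 2) \<le> infdist x C"
            using Suc by (auto simp: R_def intro!: divide_left_mono)
          then show "1 / real ((2 * m + b) + 2) - 1 / real ((2 * j + b) + 1) \<le> dist x y"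
            using y by (intro sep) auto
        qed
      qed (auto intro: zero_less_one)
    qed
    also have "\<dots> \<le> \<mu> A"
      unfolding \<mu>_def by (rule hausdorff2_outer_mono) (auto simp: R_def)
    finally show ?thesis .
  qed
  have split2: "(\<Sum>k<2 * N. g k) = (\<Sum>j<N. g (2 * j + 0)) + (\<Sum>j<N. g (2 * j + 1))"
    for N and g :: "nat \<Rightarrow> ennreal"
    by (induction N) (auto simp: ac_simps)
  have "(\<Sum>k<N. \<mu> (R k)) \<le> \<mu> A + \<mu> A" for N
  proof -
    have "(\<Sum>k<N. \<mu> (R k)) \<le> (\<Sum>k<2 * N. \<mu> (R k))"
      by (rule sum_mono2) auto
    also have "\<dots> \<le> \<mu> A + \<mu> A"
      unfolding split2 by (intro add_mono half)
    finally show ?thesis .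
  qed
  then have "(\<Sum>k. \<mu> (R k)) \<le> \<mu> A + \<mu> A"
    by (intro suminf_le_const) auto
  then have fin_sum: "(\<Sum>k. \<mu> (R k)) < top"
    using fin by (auto simp: less_top[symmetric] top_unique)
  have bound: "\<mu> (A \<inter> C) + \<mu> (A - C) \<le> \<mu> A + (\<Sum>k. \<mu> (R (k + n)))" for n
  proof -
    have "x \<in> P n \<union> (\<Union>k. R (k + n))" if x: "x \<in> A - C" for x
    proof (cases "x \<in> P n")
      case False
      have "0 < infdist x C"
        using x C by (intro infdist_pos_not_in_closed) auto
      then obtain m where "inverse (real (Suc m)) < infdist x C"
        using reals_Archimedean by blast
      then have ex: "1 / real (m + 1) \<le> infdist x C"
        by (simp add: inverse_eq_divide add.commute)
      define l where "l = (LEAST m. 1 / real (m + 1) \<le> infdist x C)"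
      have l: "1 / real (l + 1) \<le> infdist x C"
        unfolding l_def by (rule LeastI[of "\<lambda>m. 1 / real (m + 1) \<le> infdist x C", OF ex])
      have "n < l"
      proof (rule ccontr)
        assume "\<not> n < l"
        then have "1 / real (n + 1) \<le> 1 / real (l + 1)" by (intro divide_left_mono) auto
        then show False using l False x by (auto simp: P_def)
      qed
      then obtain k where k: "l = Suc (k + n)"
        by (metis add.commute less_imp_Suc_add)
      have "infdist x C < 1 / real (k + n + 1)"
        using not_less_Least[of "k + n" "\<lambda>m. 1 / real (m + 1) \<le> infdist x C"] k
        unfolding l_def[symmetric] by auto
      then have "x \<in> R (k + n)" using l x k by (auto simp: R_def)
      then show ?thesis by blast
    qed auto
    then have "\<mu> (A - C) \<le> \<mu> (P n \<union> (\<Union>k. R (k + n)))"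
      unfolding \<mu>_def by (intro hausdorff2_outer_mono) blast
    also have "\<dots> \<le> \<mu> (P n) + \<mu> (\<Union>k. R (k + n))"
      unfolding \<mu>_def by (rule hausdorff2_outer_Un_le)
    also have "\<dots> \<le> \<mu> (P n) + (\<Sum>k. \<mu> (R (k + n)))"
      unfolding \<mu>_def by (intro add_left_mono hausdorff2_outer_UN_le)
    finally have "\<mu> (A \<inter> C) + \<mu> (A - C) \<le> (\<mu> (A \<inter> C) + \<mu> (P n)) + (\<Sum>k. \<mu> (R (k + n)))"
      by (simp add: add.assoc add_left_mono)
    also have "\<mu> (A \<inter> C) + \<mu> (P n) \<le> \<mu> (A \<inter> C \<union> P n)"
      unfolding \<mu>_def
    proof (rule hausdorff2_outer_separated)
      show "0 < 1 / real (n + 1)" by simp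
      show "1 / real (n + 1) \<le> dist x y" if "x \<in> A \<inter> C" "y \<in> P n" for x y
        using that infdist_le[of x C y] by (auto simp: P_def dist_commute)
    qed
    also have "\<mu> (A \<inter> C \<union> P n) \<le> \<mu> A"
      unfolding \<mu>_def by (rule hausdorff2_outer_mono) (auto simp: P_def)
    finally show ?thesis by (simp add: add_right_mono)
  qed
  show ?thesis
    unfolding \<mu>_def[symmetric]
  proof (rule ennreal_le_epsilon)
    fix e :: real assume e: "0 < e"
    have lim: "(\<lambda>n. (\<Sum>k<n. \<mu> (R k)) + ennreal e) \<longlonglongrightarrow> (\<Sum>k. \<mu> (R k)) + ennreal e"
      by (intro tendsto_add summable_LIMSEQ tendsto_const) auto
    have "(\<Sum>k. \<mu> (R k)) < (\<Sum>k. \<mu> (R k)) + ennreal e"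
      by (intro ennreal_add_strict) (use fin_sum e in auto)
    from order_tendstoD(1)[OF lim this]
    obtain n where "(\<Sum>k. \<mu> (R k)) < (\<Sum>k<n. \<mu> (R k)) + ennreal e"
      by (auto simp: eventually_sequentially)
    moreover have "(\<Sum>k. \<mu> (R k)) = (\<Sum>k<n. \<mu> (R k)) + (\<Sum>k. \<mu> (R (k + n)))"
      by (subst suminf_offset[of _ n]) (auto simp: add.commute)
    ultimately have "(\<Sum>k. \<mu> (R (k + n))) \<le> ennreal e"
      by (auto simp: ennreal_add_left_cancel_less)
    then have "\<mu> A + (\<Sum>k. \<mu> (R (k + n))) \<le> \<mu> A + ennreal e"
      by (rule add_left_mono)
    with bound[of n] show "\<mu> (A \<inter> C) + \<mu> (A - C) \<le> \<mu> A + ennreal e"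
      by (rule order_trans)
  qed
qed simp

lemma measure_space_hausdorff2:
  "measure_space UNIV (sets borel) (hausdorff2_outer :: 'a::metric_space set \<Rightarrow> ennreal)"
proof -
  let ?f = "hausdorff2_outer :: 'a set \<Rightarrow> ennreal"
  let ?L = "lambda_system UNIV (Pow UNIV) ?f"
  interpret sigma_algebra UNIV "Pow UNIV :: 'a set set" by (rule sigma_algebra_Pow)
  have "outer_measure_space (Pow UNIV) ?f"
    unfolding outer_measure_space_def positive_def increasing_def countably_subadditive_def
    by (auto intro: hausdorff2_outer_mono hausdorff2_outer_UN_le)
  from caratheodory_lemma[OF this] have L: "measure_space UNIV ?L ?f" .
  then interpret L: sigma_algebra UNIV ?L by (simp add: measure_space_def)
  have "C \<in> ?L" if "closed C" for C
  proof (cases "C = {}")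
    case False
    have "?f (A \<inter> C) + ?f (A - C) = ?f A" for A
      using hausdorff2_outer_closed_split[OF that False, of A]
        hausdorff2_outer_Un_le[of "A \<inter> C" "A - C"]
      by (simp add: Int_Diff_Un antisym)
    then show ?thesis
      by (simp add: lambda_system_def Int_commute Diff_eq)
  qed (simp add: lambda_system_def)
  then have "Collect closed \<subseteq> ?L" by blast
  then have "sigma_sets UNIV (Collect closed) \<subseteq> ?L" by (rule L.sigma_sets_subset)
  then have sub: "sets borel \<subseteq> ?L"
    unfolding borel_eq_closed by (subst sets_measure_of) auto
  have "countably_additive ?L ?f" using L unfolding measure_space_def by blast
  then have "countably_additive (sets borel) ?f"
    unfolding countably_additive_def
  proof (intro allI impI)
    fix S :: "nat \<Rightarrow> 'a set"
    assume "range S \<subseteq> sets borel" "disjoint_family S" "\<Union> (range S) \<in> sets borel"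
    moreover from this sub have "range S \<subseteq> ?L" "\<Union> (range S) \<in> ?L" by auto
    ultimately show "(\<Sum>i. ?f (S i)) = ?f (\<Union> (range S))"
      using \<open>countably_additive ?L ?f\<close> unfolding countably_additive_def by blast
  qed
  then show ?thesis
    using sets.sigma_algebra_axioms[of "borel :: 'a measure"]
    by (simp add: measure_space_def positive_def)
qed

lemma sets_surface_measure [simp, measurable_cong]: "sets surface_measure = sets borel"
  unfolding surface_measure_def using sets.sigma_sets_eq[of "borel :: (real^3) measure"] by simp

lemma emeasure_surface_measure:
  assumes "A \<in> sets borel"
  shows "emeasure surface_measure A = hausdorff2_outer A"
proof -
  have *: "sigma_sets UNIV (sets (borel :: (real^3) measure)) = sets borel"
    using sets.sigma_sets_eq[of "borel :: (real^3) measure"] by simp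
  show ?thesis
    unfolding surface_measure_def emeasure_measure_of_conv *
    using assms measure_space_hausdorff2[where 'a = "real^3"] by simp
qed


section \<open>Domains on which the divergence theorem holds\<close>

text \<open>Federer's measure-theoretic exterior unit normal; for a boundary point near which \<open>\<Omega>\<close> lies
  on one side of a \<open>C\<^sup>1\<close> surface it is the usual outward normal.\<close>

definition outward_unit_normal :: "(real^3) set \<Rightarrow> real^3 \<Rightarrow> real^3 \<Rightarrow> bool" where
  "outward_unit_normal \<Omega> x \<nu> \<longleftrightarrow>
     norm \<nu> = 1 \<and>
     ((\<lambda>r. measure lborel {y \<in> ball x r. y \<in> \<Omega> \<and> (y - x) \<bullet> \<nu> > 0} / r ^ 3) \<longlongrightarrow> 0) (at_right 0) \<and>
     ((\<lambda>r. measure lborel {y \<in> ball x r. y \<notin> \<Omega> \<and> (y - x) \<bullet> \<nu> < 0} / r ^ 3) \<longlongrightarrow> 0) (at_right 0)"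

text \<open>The normal is only required almost everywhere, to admit domains with edges and corners.
  Finite surface area and measurability of \<open>n\<close> make the flux integrals exist.\<close>

definition divergence_domain :: "(real^3) set \<Rightarrow> (real^3 \<Rightarrow> real^3) \<Rightarrow> bool" where
  "divergence_domain \<Omega> n \<longleftrightarrow>
     open \<Omega> \<and> connected \<Omega> \<and> bounded \<Omega> \<and> \<Omega> \<noteq> {} \<and>
     emeasure surface_measure (frontier \<Omega>) < \<infinity> \<and>
     set_borel_measurable borel (frontier \<Omega>) n \<and>
     (AE x in surface_measure. x \<in> frontier \<Omega> \<longrightarrow> outward_unit_normal \<Omega> x (n x)) \<and>
     (\<forall>F U. open U \<and> closure \<Omega> \<subseteq> U \<and> C_on 1 U F \<longrightarrow>
        (LINT x:\<Omega>|lborel. divergence F x) = (LINT x:frontier \<Omega>|surface_measure. F x \<bullet> n x))"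


section \<open>Energies\<close>

definition energy ::
    "(real^3) set \<Rightarrow> (real \<Rightarrow> real^3 \<Rightarrow> real) \<Rightarrow> (real \<Rightarrow> real^3 \<Rightarrow> real^3) \<Rightarrow> real \<Rightarrow> real" where
  "energy \<Omega> f F t =
     (LINT x:\<Omega>|lborel. 1 / 2 * ((norm (grad (f t) x))\<^sup>2 + (divergence (F t) x)\<^sup>2))"

end

theory Submission
  imports Defs
begin

text \<open>
  Write \<open>q = \<nabla> \<cdot> J\<close>.  The gradient of the equation for \<open>T\<close> and the divergence of the equation
  for \<open>J\<close>, in which the curl drops out, give
  \<open>\<partial>\<^sub>t \<nabla>T = - c\<^sub>0 \<nabla>q\<close> and \<open>\<partial>\<^sub>t q = - c\<^sub>0 \<Delta>T - q/\<tau>\<close>.  Hence the energy density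
  satisfies \<open>\<partial>\<^sub>t e = - \<nabla> \<cdot> (c\<^sub>0 q \<nabla>T) - q\<^sup>2/\<tau>\<close>; the flux term integrates to zero over \<open>\<Omega>\<close> by
  the divergence theorem and the boundary condition.  The pair \<open>(\<phi>, \<psi>)\<close> obeys the
  same system with coupling to the curl of \<open>J\<close> and without relaxation.
\<close>

section \<open>Directional derivatives and smooth functions\<close>

text \<open>The direction comes first, so that \<open>dir_deriv v\<close> is an operator on
  functions that can be iterated. Partial derivatives in space and in time are both instances of
  it.\<close>

definition dir_deriv :: "'a::real_normed_vector \<Rightarrow> ('a \<Rightarrow> 'b::real_normed_vector) \<Rightarrow> 'a \<Rightarrow> 'b" where
  "dir_deriv v f x = frechet_derivative f (at x) v"

lemma dir_deriv_eqI: "(f has_derivative f') (at x) \<Longrightarrow> dir_deriv v f x = f' v"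
  unfolding dir_deriv_def using frechet_derivative_at by metis

lemma has_derivative_dir_deriv:
  "f differentiable (at x) \<Longrightarrow> (f has_derivative (\<lambda>v. dir_deriv v f x)) (at x)"
  unfolding dir_deriv_def by (simp add: frechet_derivative_works)

lemma dir_deriv_add:
  "f differentiable (at x) \<Longrightarrow> g differentiable (at x) \<Longrightarrow>
   dir_deriv v (\<lambda>y. f y + g y) x = dir_deriv v f x + dir_deriv v g x"
  by (intro dir_deriv_eqI has_derivative_add has_derivative_dir_deriv)

lemma dir_deriv_scaleR:
  "f differentiable (at x) \<Longrightarrow> dir_deriv v (\<lambda>y. c *\<^sub>R f y) x = c *\<^sub>R dir_deriv v f x"
  by (intro dir_deriv_eqI has_derivative_scaleR_right has_derivative_dir_deriv)

lemma dir_deriv_sum: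
  "(\<And>i. i \<in> I \<Longrightarrow> f i differentiable (at x)) \<Longrightarrow>
   dir_deriv v (\<lambda>y. \<Sum>i\<in>I. f i y) x = (\<Sum>i\<in>I. dir_deriv v (f i) x)"
  by (intro dir_deriv_eqI has_derivative_sum has_derivative_dir_deriv)

lemma dir_deriv_vec_nth:
  fixes f :: "'a::real_normed_vector \<Rightarrow> real^'n"
  shows "f differentiable (at x) \<Longrightarrow> dir_deriv v (\<lambda>y. f y $ i) x = dir_deriv v f x $ i"
  by (intro dir_deriv_eqI bounded_linear.has_derivative[OF bounded_linear_vec_nth]
      has_derivative_dir_deriv)

lemma dir_deriv_cong_open:
  assumes "open S" "x \<in> S" "f differentiable (at x)" "\<And>y. y \<in> S \<Longrightarrow> f y = g y"
  shows "dir_deriv v g x = dir_deriv v f x"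
  by (rule dir_deriv_eqI, rule has_derivative_transform_within_open[OF has_derivative_dir_deriv])
    (use assms in auto)

text \<open>On an open set, agreement of two functions passes to their derivatives, so induction
  over the order applies. This allows a derivative to be replaced by the expression that a
  differentiation rule gives on \<open>S\<close> only.\<close>

lemma C_on_cong:
  assumes "open S" "\<And>x. x \<in> S \<Longrightarrow> f x = g x" "C_on k S f"
  shows "C_on k S g"
  using assms(2,3)
proof (induction k arbitrary: f g)
  case 0
  then show ?case using continuous_on_cong by fastforce
next
  case (Suc k)
  have df: "f differentiable (at x)" if "x \<in> S" for x using Suc.prems that by simp
  have "g differentiable (at x)" if "x \<in> S" for x
    using has_derivative_transform_within_open[OF has_derivative_dir_deriv[OF df[OF that]]
        assms(1) that Suc.prems(1)]
    by (auto simp: differentiable_def)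
  moreover have "C_on k S (\<lambda>x. frechet_derivative g (at x) v)" for v
  proof (rule Suc.IH)
    show "C_on k S (\<lambda>x. frechet_derivative f (at x) v)" using Suc.prems by simp
    show "frechet_derivative f (at x) v = frechet_derivative g (at x) v" if "x \<in> S" for x
      using dir_deriv_cong_open[OF assms(1) that df[OF that] Suc.prems(1)]
      by (simp add: dir_deriv_def)
  qed
  ultimately show ?case by simp
qed

lemma C_on_Suc_dir_deriv:
  "C_on (Suc k) S f \<longleftrightarrow> (\<forall>x\<in>S. f differentiable (at x)) \<and> (\<forall>v. C_on k S (dir_deriv v f))"
  by (simp add: dir_deriv_def[abs_def])

text \<open>Derivatives are to stay in the form \<open>dir_deriv v f\<close>, by way of
  \<open>C_on_Suc_dir_deriv\<close>, rather than being unfolded to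
  \<open>frechet_derivative\<close>.\<close>

declare C_on.simps(2)[simp del]

lemma C_on_const: "C_on k S (\<lambda>_. c)"
  by (induction k arbitrary: c) (auto simp: C_on.simps)

lemma C_on_add:
  assumes "open S" "C_on k S f" "C_on k S g"
  shows "C_on k S (\<lambda>x. f x + g x)"
  using assms(2,3)
proof (induction k arbitrary: f g)
  case 0
  then show ?case by (auto intro: continuous_on_add)
next
  case (Suc k)
  then have "C_on k S (\<lambda>x. dir_deriv v f x + dir_deriv v g x)" for v
    by (auto simp: C_on_Suc_dir_deriv)
  then have "C_on k S (dir_deriv v (\<lambda>x. f x + g x))" for v
    by (rule C_on_cong[OF assms(1), rotated])
      (use Suc.prems in \<open>simp add: C_on_Suc_dir_deriv dir_deriv_add\<close>)
  then show ?case using Suc.prems by (simp add: C_on_Suc_dir_deriv)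
qed

lemma C_on_sum:
  assumes "open S" "\<And>i. i \<in> I \<Longrightarrow> C_on k S (f i)"
  shows "C_on k S (\<lambda>x. \<Sum>i\<in>I. f i x)"
  using assms(2)
  by (induction I rule: infinite_finite_induct) (auto simp: C_on_const intro!: C_on_add assms(1))

lemma C_on_vec_nth:
  fixes f :: "'a::real_normed_vector \<Rightarrow> real^'n"
  assumes "open S" "C_on k S f"
  shows "C_on k S (\<lambda>x. f x $ i)"
  using assms(2)
proof (induction k arbitrary: f)
  case 0
  then show ?case by (auto intro: continuous_intros)
next
  case (Suc k)
  then have "C_on k S (\<lambda>x. dir_deriv v f x $ i)" for v
    by (auto simp: C_on_Suc_dir_deriv)
  then have "C_on k S (dir_deriv v (\<lambda>x. f x $ i))" for v
    by (rule C_on_cong[OF assms(1), rotated])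
      (use Suc.prems in \<open>simp add: C_on_Suc_dir_deriv dir_deriv_vec_nth\<close>)
  moreover have "(\<lambda>x. f x $ i) differentiable (at x)" if "x \<in> S" for x
    using Suc.prems that bounded_linear.has_derivative[OF bounded_linear_vec_nth]
    by (metis C_on_Suc_dir_deriv differentiable_def)
  ultimately show ?case by (simp add: C_on_Suc_dir_deriv)
qed

lemma C_on_Suc_imp_continuous_on: "C_on (Suc k) S f \<Longrightarrow> continuous_on S f"
  by (auto simp: C_on.simps intro!: continuous_at_imp_continuous_on differentiable_imp_continuous_within)

lemma C_on_subset: "C_on k S f \<Longrightarrow> S' \<subseteq> S \<Longrightarrow> C_on k S' f"
  by (induction k arbitrary: f) (auto simp: C_on.simps intro: continuous_on_subset)

lemma C_on_SucD: "C_on (Suc k) S f \<Longrightarrow> C_on k S f"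
proof (induction k arbitrary: f)
  case 0
  then show ?case by (simp add: C_on_Suc_imp_continuous_on)
next
  case (Suc k)
  then show ?case by (metis C_on_Suc_dir_deriv)
qed

lemma dir_deriv_mult:
  fixes f g :: "'a::real_normed_vector \<Rightarrow> real"
  assumes "f differentiable (at x)" "g differentiable (at x)"
  shows "dir_deriv v (\<lambda>y. f y * g y) x = f x * dir_deriv v g x + dir_deriv v f x * g x"
  by (rule dir_deriv_eqI[OF has_derivative_mult[OF assms[THEN has_derivative_dir_deriv]]])

lemma C_on_mult:
  fixes f g :: "'a::real_normed_vector \<Rightarrow> real"
  assumes "open S" "C_on k S f" "C_on k S g"
  shows "C_on k S (\<lambda>x. f x * g x)"
  using assms(2,3)
proof (induction k arbitrary: f g)
  case 0
  then show ?case by (auto intro: continuous_on_mult)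
next
  case (Suc k)
  \<comment> \<open>Each summand of the product rule keeps one factor undifferentiated;
    \<open>C_on_SucD\<close> lowers the order of that factor to the \<open>k\<close> of the
    induction hypothesis.\<close>
  have "C_on k S (\<lambda>x. f x * dir_deriv v g x + dir_deriv v f x * g x)" for v
    using Suc.prems Suc.prems[THEN C_on_SucD]
    by (intro C_on_add[OF assms(1)] Suc.IH) (auto simp: C_on_Suc_dir_deriv)
  then have "C_on k S (dir_deriv v (\<lambda>x. f x * g x))" for v
    by (rule C_on_cong[OF assms(1), rotated])
      (use Suc.prems in \<open>simp add: C_on_Suc_dir_deriv dir_deriv_mult\<close>)
  then show ?case using Suc.prems by (simp add: C_on_Suc_dir_deriv)
qed

text \<open>Taking all orders at once makes the class closed under \<open>dir_deriv\<close>, so that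
  no count of derivatives is carried through the energy computation.\<close>

abbreviation C_inf_on :: "'a::real_normed_vector set \<Rightarrow> ('a \<Rightarrow> 'b::real_normed_vector) \<Rightarrow> bool" where
  "C_inf_on S f \<equiv> \<forall>k. C_on k S f"

lemma C_inf_on_differentiable: "C_inf_on S f \<Longrightarrow> x \<in> S \<Longrightarrow> f differentiable (at x)"
  using C_on_Suc_dir_deriv by blast

lemma C_inf_on_dir_deriv: "C_inf_on S f \<Longrightarrow> C_inf_on S (dir_deriv v f)"
  using C_on_Suc_dir_deriv by blast

lemma C_inf_on_continuous: "C_inf_on S f \<Longrightarrow> continuous_on S f"
  using C_on.simps(1) by blast

lemma C_inf_on_sum:
  "open S \<Longrightarrow> (\<And>i. i \<in> I \<Longrightarrow> C_inf_on S (f i)) \<Longrightarrow> C_inf_on S (\<lambda>x. \<Sum>i\<in>I. f i x)"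
  by (simp add: C_on_sum)

section \<open>Symmetry of second derivatives\<close>

lemma has_field_derivative_line:
  fixes f :: "'a::real_normed_vector \<Rightarrow> real"
  assumes "f differentiable (at (p + a *\<^sub>R v))"
  shows "((\<lambda>s. f (p + s *\<^sub>R v)) has_field_derivative dir_deriv v f (p + a *\<^sub>R v)) (at a)"
proof -
  have *: "((\<lambda>s. p + s *\<^sub>R v) has_derivative (\<lambda>s. s *\<^sub>R v)) (at a)"
    by (auto intro!: derivative_eq_intros)
  have "((\<lambda>s. f (p + s *\<^sub>R v)) has_derivative (\<lambda>s. dir_deriv (s *\<^sub>R v) f (p + a *\<^sub>R v))) (at a)"
    using has_derivative_compose[OF * has_derivative_dir_deriv[OF assms]] .
  moreover have "dir_deriv (s *\<^sub>R v) f (p + a *\<^sub>R v) = s * dir_deriv v f (p + a *\<^sub>R v)" for s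
    using linear_frechet_derivative[OF assms] by (simp add: dir_deriv_def linear_cmul)
  ultimately show ?thesis
    by (simp add: has_field_derivative_def mult.commute[of _ "dir_deriv v f (p + a *\<^sub>R v)"])
qed

text \<open>The mean value theorem is applied twice: along \<open>v\<close> to a difference in
  direction \<open>w\<close>, then along \<open>w\<close> to \<open>dir_deriv v f\<close>. The norm
  bound lets \<open>q\<close> approach \<open>p\<close> as \<open>h\<close> shrinks.\<close>

lemma second_difference_mean_value:
  fixes f :: "'a::real_normed_vector \<Rightarrow> real"
  assumes h: "h > 0"
    and box: "\<And>a b. 0 \<le> a \<Longrightarrow> a \<le> h \<Longrightarrow> 0 \<le> b \<Longrightarrow> b \<le> h \<Longrightarrow> p + a *\<^sub>R v + b *\<^sub>R w \<in> S"
    and f: "\<And>x. x \<in> S \<Longrightarrow> f differentiable (at x)"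
    and fv: "\<And>x. x \<in> S \<Longrightarrow> dir_deriv v f differentiable (at x)"
  obtains q where "q \<in> S"
    "f (p + h *\<^sub>R v + h *\<^sub>R w) - f (p + h *\<^sub>R v) - f (p + h *\<^sub>R w) + f p
      = h * h * dir_deriv w (dir_deriv v f) q"
    "norm (q - p) \<le> h * (norm v + norm w)"
proof -
  have in1: "p + a *\<^sub>R v \<in> S" if "0 \<le> a" "a \<le> h" for a using box[of a 0] that h by simp
  have in2: "p + h *\<^sub>R w + a *\<^sub>R v \<in> S" if "0 \<le> a" "a \<le> h" for a
    using box[of a h] that h by (simp add: algebra_simps)
  \<comment> \<open>The increment \<open>g h - g 0\<close> is the second difference of
    \<open>f\<close> over the parallelogram at \<open>p\<close>.\<close>
  define g where "g a = f (p + h *\<^sub>R w + a *\<^sub>R v) - f (p + a *\<^sub>R v)" for a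
  have "\<exists>a. 0 < a \<and> a < h \<and> g h - g 0
      = (h - 0) * (dir_deriv v f (p + h *\<^sub>R w + a *\<^sub>R v) - dir_deriv v f (p + a *\<^sub>R v))"
  proof (rule MVT2[OF h])
    fix a assume "0 \<le> a" "a \<le> h"
    then show "(g has_real_derivative
        dir_deriv v f (p + h *\<^sub>R w + a *\<^sub>R v) - dir_deriv v f (p + a *\<^sub>R v)) (at a)"
      unfolding g_def by (intro DERIV_diff has_field_derivative_line f in1 in2)
  qed
  \<comment> \<open>The summand \<open>0 *\<^sub>R w\<close> is written in so that the bracket is
    the increment of one function of \<open>b\<close> between \<open>0\<close> and
    \<open>h\<close>.\<close>
  then obtain a where a: "0 < a" "a < h" and ga: "g h - g 0
      = h * (dir_deriv v f (p + a *\<^sub>R v + h *\<^sub>R w) - dir_deriv v f (p + a *\<^sub>R v + 0 *\<^sub>R w))"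
    by (auto simp: algebra_simps)
  have "\<exists>b. 0 < b \<and> b < h \<and>
      dir_deriv v f (p + a *\<^sub>R v + h *\<^sub>R w) - dir_deriv v f (p + a *\<^sub>R v + 0 *\<^sub>R w)
      = (h - 0) * dir_deriv w (dir_deriv v f) (p + a *\<^sub>R v + b *\<^sub>R w)"
    by (rule MVT2[OF h], rule has_field_derivative_line, rule fv, rule box) (use a in auto)
  then obtain b where b: "0 < b" "b < h" and gb:
      "dir_deriv v f (p + a *\<^sub>R v + h *\<^sub>R w) - dir_deriv v f (p + a *\<^sub>R v + 0 *\<^sub>R w)
      = h * dir_deriv w (dir_deriv v f) (p + a *\<^sub>R v + b *\<^sub>R w)"
    by auto
  show ?thesis
  proof
    show "p + a *\<^sub>R v + b *\<^sub>R w \<in> S" using box a b by simp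
    show "f (p + h *\<^sub>R v + h *\<^sub>R w) - f (p + h *\<^sub>R v) - f (p + h *\<^sub>R w) + f p
      = h * h * dir_deriv w (dir_deriv v f) (p + a *\<^sub>R v + b *\<^sub>R w)"
      using ga[unfolded gb] by (simp add: g_def algebra_simps)
    have "norm (a *\<^sub>R v + b *\<^sub>R w) \<le> a * norm v + b * norm w"
      using norm_triangle_ineq[of "a *\<^sub>R v" "b *\<^sub>R w"] a b by simp
    also have "\<dots> \<le> h * norm v + h * norm w"
      using a b by (intro add_mono mult_right_mono) auto
    finally show "norm (p + a *\<^sub>R v + b *\<^sub>R w - p) \<le> h * (norm v + norm w)"
      by (simp add: algebra_simps)
  qed
qed

text \<open>Schwarz's theorem. The second difference is symmetric in \<open>v\<close> and
  \<open>w\<close>, so the two mixed derivatives take a common value at points arbitrarily close to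
  \<open>p\<close>, and continuity carries the equality to \<open>p\<close>.\<close>

lemma dir_deriv_commute:
  fixes f :: "'a::real_normed_vector \<Rightarrow> real"
  assumes S: "open S" "p \<in> S" and f: "C_on 2 S f"
  shows "dir_deriv w (dir_deriv v f) p = dir_deriv v (dir_deriv w f) p"
proof (rule ccontr)
  let ?A = "dir_deriv w (dir_deriv v f)" and ?B = "dir_deriv v (dir_deriv w f)"
  assume neq: "?A p \<noteq> ?B p"
  have f2: "\<And>x. x \<in> S \<Longrightarrow> f differentiable (at x)"
    "\<And>x u. x \<in> S \<Longrightarrow> dir_deriv u f differentiable (at x)"
    "\<And>u u'. continuous_on S (dir_deriv u (dir_deriv u' f))"
    using f by (simp_all add: numeral_2_eq_2 C_on_Suc_dir_deriv)
  \<comment> \<open>Half the gap: a common value of \<open>?A\<close> and \<open>?B\<close> that is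
    within \<open>e\<close> of both \<open>?A p\<close> and \<open>?B p\<close> contradicts the
    triangle inequality.\<close>
  define e where "e = dist (?A p) (?B p) / 2"
  have e: "e > 0" using neq by (simp add: e_def)
  obtain d1 where d1: "d1 > 0" "\<And>q. q \<in> S \<Longrightarrow> dist q p < d1 \<Longrightarrow> dist (?A q) (?A p) < e"
    using f2(3) S(2) e unfolding continuous_on_iff by metis
  obtain d2 where d2: "d2 > 0" "\<And>q. q \<in> S \<Longrightarrow> dist q p < d2 \<Longrightarrow> dist (?B q) (?B p) < e"
    using f2(3) S(2) e unfolding continuous_on_iff by metis
  obtain d3 where d3: "d3 > 0" "ball p d3 \<subseteq> S" using S openE by blast
  define d where "d = min d1 (min d2 d3)"
  \<comment> \<open>The summand \<open>1\<close> keeps the denominator positive when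
    \<open>v\<close> and \<open>w\<close> both vanish, and makes
    \<open>h * (norm v + norm w)\<close> strictly smaller than \<open>d\<close>.\<close>
  define h where "h = d / (norm v + norm w + 1)"
  have d: "d > 0" using d1 d2 d3 by (simp add: d_def)
  have nn: "0 < norm v + norm w + 1" by (smt (verit) norm_ge_zero)
  have h: "h > 0" using d nn by (simp add: h_def)
  have hd: "h * (norm v + norm w) < d"
    using d nn by (simp add: h_def divide_simps algebra_simps)
  have box: "p + a *\<^sub>R v + b *\<^sub>R w \<in> S" if "0 \<le> a" "a \<le> h" "0 \<le> b" "b \<le> h" for a b
  proof -
    have "norm (a *\<^sub>R v + b *\<^sub>R w) \<le> a * norm v + b * norm w"
      using norm_triangle_ineq[of "a *\<^sub>R v" "b *\<^sub>R w"] that by simp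
    also have "\<dots> \<le> h * norm v + h * norm w"
      using that by (intro add_mono mult_right_mono) auto
    finally have "norm (a *\<^sub>R v + b *\<^sub>R w) < d3" using hd by (simp add: algebra_simps d_def)
    moreover have "dist p (p + a *\<^sub>R v + b *\<^sub>R w) = norm (a *\<^sub>R v + b *\<^sub>R w)"
      by (metis add.assoc add_diff_cancel_left' dist_commute dist_norm)
    ultimately show ?thesis using d3 by auto
  qed
  have box': "p + a *\<^sub>R w + b *\<^sub>R v \<in> S" if "0 \<le> a" "a \<le> h" "0 \<le> b" "b \<le> h" for a b
    using box[of b a] that by (simp add: algebra_simps)
  obtain q1 where q1: "q1 \<in> S" "f (p + h *\<^sub>R v + h *\<^sub>R w) - f (p + h *\<^sub>R v) - f (p + h *\<^sub>R w) + f p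
      = h * h * ?A q1" "norm (q1 - p) \<le> h * (norm v + norm w)"
    using second_difference_mean_value[OF h box f2(1) f2(2)] by blast
  obtain q2 where q2: "q2 \<in> S" "f (p + h *\<^sub>R w + h *\<^sub>R v) - f (p + h *\<^sub>R w) - f (p + h *\<^sub>R v) + f p
      = h * h * ?B q2" "norm (q2 - p) \<le> h * (norm w + norm v)"
    using second_difference_mean_value[OF h box' f2(1) f2(2)] by blast
  have "h * h * ?A q1 = h * h * ?B q2" using q1(2) q2(2) by (simp add: algebra_simps)
  then have "?A q1 = ?B q2" using h by simp
  moreover have "dist (?A q1) (?A p) < e"
    using q1 hd by (intro d1) (auto simp: dist_norm d_def)
  moreover have "dist (?B q2) (?B p) < e"
    using q2 hd by (intro d2) (auto simp: dist_norm d_def algebra_simps)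
  ultimately have "dist (?A p) (?B p) < 2 * e"
    using dist_triangle3[of "?A p" "?B p" "?A q1"] by simp
  then show False by (simp add: e_def)
qed

section \<open>Spatial and temporal derivatives of fields\<close>

text \<open>Chain rule through \<open>y\<close> \<mapsto> \<open>(t, y)\<close>. Spatial derivatives
  become space-time derivatives in the direction \<open>(0, h)\<close>, so that
  \<open>dir_deriv_commute\<close> also exchanges them with time derivatives.\<close>

lemma has_derivative_slice:
  fixes f :: "'a::real_normed_vector \<times> 'b::real_normed_vector \<Rightarrow> 'c::real_normed_vector"
  assumes "f differentiable (at (t, x))"
  shows "((\<lambda>y. f (t, y)) has_derivative (\<lambda>h. dir_deriv (0, h) f (t, x))) (at x)"
proof -
  have "((\<lambda>y. (t, y)) has_derivative (\<lambda>h. (0, h))) (at x)"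
    by (auto intro!: derivative_eq_intros)
  from has_derivative_compose[OF this has_derivative_dir_deriv[OF assms]] show ?thesis .
qed

lemma dir_deriv_slice:
  fixes f :: "'a::real_normed_vector \<times> 'b::real_normed_vector \<Rightarrow> 'c::real_normed_vector"
  assumes "f differentiable (at (t, x))"
  shows "dir_deriv v (\<lambda>y. f (t, y)) x = dir_deriv (0, v) f (t, x)"
  by (rule dir_deriv_eqI[OF has_derivative_slice[OF assms]])

text \<open>The set \<open>A\<close> serves two purposes: \<open>UNIV\<close> gives
  \<open>time_deriv\<close>, and an interval gives the one-sided derivatives at its ends for the
  fundamental theorem of calculus.\<close>

lemma has_vector_derivative_slice:
  fixes f :: "real \<times> 'b::real_normed_vector \<Rightarrow> 'c::real_normed_vector"
  assumes "f differentiable (at (t, x))"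
  shows "((\<lambda>s. f (s, x)) has_vector_derivative dir_deriv (1, 0) f (t, x)) (at t within A)"
proof -
  have "((\<lambda>s. (s, x)) has_derivative (\<lambda>s. (s, 0))) (at t within A)"
    by (auto intro!: derivative_eq_intros)
  from has_derivative_compose[OF this has_derivative_dir_deriv[OF assms]]
  have "((\<lambda>s. f (s, x)) has_derivative (\<lambda>s. dir_deriv (s *\<^sub>R (1, 0)) f (t, x))) (at t within A)"
    by simp
  then show ?thesis
    using linear_frechet_derivative[OF assms]
    by (simp add: has_vector_derivative_def dir_deriv_def linear_cmul del: scaleR_Pair)
qed

text \<open>The differential equations hold on a closed time interval times \<Omega>, which is not
  open in space-time. At a fixed time they hold on an open set of space, and that is enough to
  differentiate them in space.\<close>

lemma dir_deriv_cong_slice: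
  fixes f g :: "'a::real_normed_vector \<times> 'b::real_normed_vector \<Rightarrow> 'c::real_normed_vector"
  assumes "open S" "x \<in> S" "f differentiable (at (t, x))" "g differentiable (at (t, x))"
    and "\<And>y. y \<in> S \<Longrightarrow> f (t, y) = g (t, y)"
  shows "dir_deriv (0, v) f (t, x) = dir_deriv (0, v) g (t, x)"
proof -
  have "(\<lambda>y. f (t, y)) differentiable (at x)"
    using has_derivative_slice[OF assms(3)] by (auto simp: differentiable_def)
  then show ?thesis
    using dir_deriv_cong_open[OF assms(1,2), of "\<lambda>y. f (t, y)" "\<lambda>y. g (t, y)" v] assms
    by (simp add: dir_deriv_slice)
qed

lemma C_on_1_slice_vec_lambda:
  fixes P :: "'n::finite \<Rightarrow> 'a::real_normed_vector \<times> 'b::real_normed_vector \<Rightarrow> real"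
  assumes "open U" "\<And>i. C_on 1 U (P i)"
  shows "C_on 1 {x. (t, x) \<in> U} (\<lambda>x. \<chi> i. P i (t, x))"
proof -
  have P: "P i differentiable (at p)" if "p \<in> U" for p i
    using assms(2) that by (auto simp: C_on_Suc_dir_deriv)
  have *: "((\<lambda>x. \<chi> i. P i (t, x)) has_derivative (\<lambda>h. \<chi> i. dir_deriv (0, h) (P i) (t, x))) (at x)"
    if "(t, x) \<in> U" for x
    by (rule has_derivative_componentwise_within[THEN iffD2])
      (auto simp: Basis_vec_def inner_axis intro!: has_derivative_slice P that)
  have "continuous_on {x. (t, x) \<in> U} (\<lambda>x. dir_deriv (0, v) (P i) (t, x))" for i v
    by (rule continuous_on_compose2[where t = U and g = "dir_deriv (0, v) (P i)"])
      (use assms(2) in \<open>auto simp: C_on_Suc_dir_deriv intro!: continuous_intros\<close>)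
  then have "continuous_on {x. (t, x) \<in> U} (\<lambda>x. \<chi> i. dir_deriv (0, v) (P i) (t, x))" for v
    by (intro continuous_on_vec_lambda)
  then have "continuous_on {x. (t, x) \<in> U} (dir_deriv v (\<lambda>x. \<chi> i. P i (t, x)))" for v
    by (rule continuous_on_eq) (auto simp: dir_deriv_eqI[OF *])
  then show ?thesis
    using * by (auto simp: C_on_Suc_dir_deriv differentiable_def)
qed

lemma grad_eq_dir_deriv:
  assumes "case_prod u differentiable (at (t, x))"
  shows "grad (u t) x $ i = dir_deriv (0, axis i 1) (case_prod u) (t, x)"
  using dir_deriv_slice[OF assms] by (simp add: grad_def dir_deriv_def)

lemma jacobian_eq_dir_deriv:
  fixes u :: "'t::real_normed_vector \<Rightarrow> real^'n \<Rightarrow> real^'m"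
  assumes "case_prod u differentiable (at (t, x))"
  shows "jacobian (u t) (at x) $ i $ j = dir_deriv (0, axis j 1) (\<lambda>p. case_prod u p $ i) (t, x)"
  using dir_deriv_slice[OF assms] dir_deriv_vec_nth[OF assms]
  by (simp add: jacobian_def matrix_def dir_deriv_def)

lemma divergence_eq_dir_deriv:
  assumes "case_prod u differentiable (at (t, x))"
  shows "divergence (u t) x = (\<Sum>i\<in>UNIV. dir_deriv (0, axis i 1) (\<lambda>p. case_prod u p $ i) (t, x))"
  by (simp add: divergence_def trace_def jacobian_eq_dir_deriv[OF assms])

lemma time_deriv_eq_dir_deriv:
  assumes "case_prod u differentiable (at (t, x))"
  shows "time_deriv u t x = dir_deriv (1, 0) (case_prod u) (t, x)"
  using has_vector_derivative_slice[OF assms, of UNIV]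
  by (simp add: time_deriv_def vector_derivative_at)

lemma smooth_fieldE:
  assumes "smooth_field t\<^sub>f \<Omega> u"
  obtains U where "open U" "{0..t\<^sub>f} \<times> closure \<Omega> \<subseteq> U" "C_inf_on U (case_prod u)"
  using assms unfolding smooth_field_def by blast

lemma continuous_on_slice:
  assumes "continuous_on U g" "{t} \<times> S \<subseteq> U"
  shows "continuous_on S (\<lambda>x. g (t, x))"
  by (rule continuous_on_compose2[OF assms(1)]) (use assms(2) in \<open>auto intro: continuous_intros\<close>)

text \<open>Continuity is wanted up to the boundary: for bounded \<Omega> it yields integrability of
  the energy density.\<close>

lemma continuous_on_grad:
  assumes "smooth_field t\<^sub>f \<Omega> f" "t \<in> {0..t\<^sub>f}"
  shows "continuous_on (closure \<Omega>) (grad (f t))"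
proof -
  obtain U where U: "open U" "{0..t\<^sub>f} \<times> closure \<Omega> \<subseteq> U" "C_inf_on U (case_prod f)"
    using assms(1) by (rule smooth_fieldE)
  have "continuous_on (closure \<Omega>) (\<lambda>x. \<chi> i. dir_deriv (0, axis i 1) (case_prod f) (t, x))"
    by (intro continuous_on_vec_lambda continuous_on_slice[where U = U] C_inf_on_continuous
        C_inf_on_dir_deriv[OF U(3)]) (use U(2) assms(2) in auto)
  then show ?thesis
  proof (rule continuous_on_eq)
    fix x assume "x \<in> closure \<Omega>"
    then have "(t, x) \<in> U" using U(2) assms(2) by blast
    then show "(\<chi> i. dir_deriv (0, axis i 1) (case_prod f) (t, x)) = grad (f t) x"
      using C_inf_on_differentiable[OF U(3)] by (simp add: vec_eq_iff grad_eq_dir_deriv)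
  qed
qed

lemma continuous_on_divergence:
  assumes "smooth_field t\<^sub>f \<Omega> F" "t \<in> {0..t\<^sub>f}"
  shows "continuous_on (closure \<Omega>) (divergence (F t))"
proof -
  obtain U where U: "open U" "{0..t\<^sub>f} \<times> closure \<Omega> \<subseteq> U" "C_inf_on U (case_prod F)"
    using assms(1) by (rule smooth_fieldE)
  have sm: "C_inf_on U (\<lambda>p. case_prod F p $ i)" for i
    using U by (simp add: C_on_vec_nth)
  have "continuous_on (closure \<Omega>)
      (\<lambda>x. \<Sum>i\<in>UNIV. dir_deriv (0, axis i 1) (\<lambda>p. case_prod F p $ i) (t, x))"
    by (intro continuous_on_sum continuous_on_slice[where U = U] C_inf_on_continuous
        C_inf_on_dir_deriv[OF sm]) (use U(2) assms(2) in auto)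
  then show ?thesis
  proof (rule continuous_on_eq)
    fix x assume "x \<in> closure \<Omega>"
    then have "(t, x) \<in> U" using U(2) assms(2) by blast
    then show "(\<Sum>i\<in>UNIV. dir_deriv (0, axis i 1) (\<lambda>p. case_prod F p $ i) (t, x))
        = divergence (F t) x"
      using C_inf_on_differentiable[OF U(3)] by (simp add: divergence_eq_dir_deriv)
  qed
qed

section \<open>Integration\<close>

text \<open>The closure of a bounded set is compact, so \<open>f\<close> is integrable there and
  hence on the smaller set.\<close>

lemma set_integrable_bounded_continuous:
  fixes f :: "'a::euclidean_space \<Rightarrow> 'b::{banach, second_countable_topology}"
  assumes "bounded S" "S \<in> sets borel" "continuous_on (closure S) f"
  shows "set_integrable lborel S f"
proof (rule set_integrable_subset)
  show "set_integrable lborel (closure S) f"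
    unfolding set_integrable_def
    using assms by (intro borel_integrable_compact) auto
qed (use assms closure_subset in auto)

text \<open>The set where \<open>g\<close> does not vanish is open by continuity and null because
  the integral is zero; a nonempty open set has positive measure.\<close>

lemma set_integral_zero_imp_zero_on_open:
  fixes g :: "'a::euclidean_space \<Rightarrow> real"
  assumes "open S" "continuous_on S g" "\<And>x. x \<in> S \<Longrightarrow> 0 \<le> g x"
    and "set_integrable lborel S g" "(LINT x:S|lborel. g x) = 0" "x \<in> S"
  shows "g x = 0"
proof (rule ccontr)
  assume "g x \<noteq> 0"
  let ?N = "{x \<in> S. g x \<noteq> 0}"
  have "open ?N"
    using continuous_open_preimage[OF assms(2,1), of "- {0}"]
    by (simp add: vimage_def Collect_conj_eq Int_commute open_Compl)
  have "AE x in lborel. indicator S x *\<^sub>R g x = 0"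
    using assms(3-5) unfolding set_integrable_def set_lebesgue_integral_def
    by (subst (asm) integral_nonneg_eq_0_iff_AE) (auto simp: indicator_def)
  then have "AE x in lebesgue. indicator S x *\<^sub>R g x = 0"
    by (rule AE_completion)
  \<comment> \<open>Nullity of \<open>?N\<close> is phrased as almost everywhere membership in the
    closed set \<open>{}\<close>, from which membership follows at every point of the open set
    \<open>?N\<close>.\<close>
  then have "AE x in lebesgue. x \<in> ?N \<longrightarrow> x \<in> {}"
    by eventually_elim (auto simp: indicator_def)
  with mem_closed_if_AE_lebesgue_open[OF \<open>open ?N\<close> closed_empty] \<open>g x \<noteq> 0\<close> assms(6)
  show False by blast
qed

text \<open>Instead of differentiating under the integral, the fundamental theorem of calculus is
  applied in time for each \<open>x\<close>, and Fubini's theorem exchanges the two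
  integrals.\<close>

lemma set_integral_time_derivative:
  fixes u u' :: "real \<Rightarrow> 'a::euclidean_space \<Rightarrow> real"
  assumes ab: "a \<le> b" and S: "bounded S" "S \<in> sets borel"
    and cont: "continuous_on ({a..b} \<times> closure S) (case_prod u')"
    and deriv: "\<And>t x. t \<in> {a..b} \<Longrightarrow> x \<in> S \<Longrightarrow>
      ((\<lambda>s. u s x) has_vector_derivative u' t x) (at t within {a..b})"
    and int: "set_integrable lborel S (u a)" "set_integrable lborel S (u b)"
  shows "(LINT x:S|lborel. u b x) - (LINT x:S|lborel. u a x)
    = (LINT t:{a..b}|lborel. LINT x:S|lborel. u' t x)"
proof -
  have "set_integrable lborel ({a..b} \<times> S) (case_prod u')"
    using S cont by (intro set_integrable_bounded_continuous)
      (auto simp: closure_Times bounded_Times intro: borel_Times)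
  \<comment> \<open>Joint integrability for Fubini's theorem; the indicator of the product set
    splits into the two indicators.\<close>
  then have *: "integrable (lborel \<Otimes>\<^sub>M lborel)
      (\<lambda>(t, x). indicator {a..b} t *\<^sub>R indicator S x *\<^sub>R u' t x)"
    unfolding set_integrable_def lborel_prod
    by (rule Bochner_Integration.integrable_cong[THEN iffD1, rotated 2])
      (auto simp: indicator_def)
  have FTC: "(LINT t:{a..b}|lborel. u' t x) = u b x - u a x" if "x \<in> S" for x
    unfolding set_lebesgue_integral_def
  proof (rule integral_FTC_atLeastAtMost[OF ab])
    have "continuous_on {a..b} (case_prod u' \<circ> (\<lambda>t. (t, x)))"
      by (intro continuous_on_compose continuous_intros continuous_on_subset[OF cont])
        (use that closure_subset in auto)
    then show "continuous_on {a..b} (\<lambda>t. u' t x)" by (simp add: o_def)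
  qed (use deriv that in auto)
  have "(LINT x:S|lborel. u b x) - (LINT x:S|lborel. u a x) = (LINT x:S|lborel. u b x - u a x)"
    using int by (simp add: set_integral_diff)
  also have "\<dots> = (LINT x:S|lborel. LINT t:{a..b}|lborel. u' t x)"
    using S by (intro set_lebesgue_integral_cong) (auto simp: FTC)
  also have "\<dots> = (LINT x|lborel. LINT t|lborel. indicator {a..b} t *\<^sub>R indicator S x *\<^sub>R u' t x)"
    unfolding set_lebesgue_integral_def integral_scaleR_right[symmetric]
    by (simp add: mult.left_commute)
  also have "\<dots> = (LINT t|lborel. LINT x|lborel. indicator {a..b} t *\<^sub>R indicator S x *\<^sub>R u' t x)"
    by (rule lborel_pair.Fubini_integral[OF *])
  finally show ?thesis
    by (simp add: set_lebesgue_integral_def)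
qed

section \<open>Energy balance\<close>

lemma norm_squared_vec: "(norm (v::real^'n))\<^sup>2 = (\<Sum>i\<in>UNIV. (v $ i)\<^sup>2)"
  by (simp add: norm_vec_def L2_set_def sum_nonneg)

text \<open>The constants \<open>c\<close>, \<open>d\<close>, \<open>r\<close> and the third field
  \<open>G\<close> are kept general so that one balance covers both pairs of unknowns. The interval
  from \<open>a\<close> to \<open>b\<close> is arbitrary because monotonicity compares two arbitrary
  times.\<close>

lemma energy_balance:
  fixes f :: "real \<Rightarrow> real^3 \<Rightarrow> real" and F G :: "real \<Rightarrow> real^3 \<Rightarrow> real^3"
  assumes domain: "divergence_domain \<Omega> n"
    and smooth: "smooth_field t\<^sub>f \<Omega> f" "smooth_field t\<^sub>f \<Omega> F" "smooth_field t\<^sub>f \<Omega> G"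
    and eq_f: "\<And>t x. t \<in> {0..t\<^sub>f} \<Longrightarrow> x \<in> \<Omega> \<Longrightarrow>
      time_deriv f t x + c * divergence (F t) x = 0"
    and eq_F: "\<And>t x. t \<in> {0..t\<^sub>f} \<Longrightarrow> x \<in> \<Omega> \<Longrightarrow>
      time_deriv F t x + c *\<^sub>R grad (f t) x + d *\<^sub>R curl (G t) x = - (r *\<^sub>R F t x)"
    and boundary: "\<And>t. t \<in> {0..t\<^sub>f} \<Longrightarrow>
      (LINT x:frontier \<Omega>|surface_measure. c * divergence (F t) x * (grad (f t) x \<bullet> n x)) = 0"
    and ab: "0 \<le> a" "a \<le> b" "b \<le> t\<^sub>f"
  shows "energy \<Omega> f F b - energy \<Omega> f F a
    = - r * (LINT s:{a..b}|lborel. (LINT x:\<Omega>|lborel. (divergence (F s) x)\<^sup>2))"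
proof -
  have \<Omega>: "open \<Omega>" "bounded \<Omega>" using domain by (auto simp: divergence_domain_def)
  have \<Omega>_borel: "\<Omega> \<in> sets borel" using \<Omega> by simp
  obtain U1 U2 U3 where U123: "open U1" "{0..t\<^sub>f} \<times> closure \<Omega> \<subseteq> U1" "C_inf_on U1 (case_prod f)"
      "open U2" "{0..t\<^sub>f} \<times> closure \<Omega> \<subseteq> U2" "C_inf_on U2 (case_prod F)"
      "open U3" "{0..t\<^sub>f} \<times> closure \<Omega> \<subseteq> U3" "C_inf_on U3 (case_prod G)"
    using smooth by (metis smooth_fieldE)
  \<comment> \<open>One common neighbourhood, on which all three fields are smooth.\<close>
  define U where "U = U1 \<inter> U2 \<inter> U3"
  have U: "open U" "{0..t\<^sub>f} \<times> closure \<Omega> \<subseteq> U" using U123 by (auto simp: U_def)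
  have UI: "(t, x) \<in> U" if "t \<in> {0..t\<^sub>f}" "x \<in> \<Omega>" for t x
    using U(2) that closure_subset by blast
  have smooth_U: "C_inf_on U (case_prod f)" "C_inf_on U (case_prod F)" "C_inf_on U (case_prod G)"
    using U123 by (auto simp: U_def intro: C_on_subset)

  \<comment> \<open>Scalar functions on space-time and their derivatives\<close>
  define D :: "3 \<Rightarrow> (real \<times> (real^3) \<Rightarrow> real) \<Rightarrow> real \<times> (real^3) \<Rightarrow> real"
    where "D i = dir_deriv (0, axis i 1)" for i
  define Dt :: "(real \<times> (real^3) \<Rightarrow> real) \<Rightarrow> real \<times> (real^3) \<Rightarrow> real" where "Dt = dir_deriv (1, 0)"
  define f' where "f' = case_prod f"
  define F' G' where "F' i = (\<lambda>p. case_prod F p $ i)" and "G' i = (\<lambda>p. case_prod G p $ i)" for i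
  define q where "q = (\<lambda>p. \<Sum>i\<in>UNIV. D i (F' i) p)"
  have sm: "C_inf_on U f'" "C_inf_on U (F' i)" "C_inf_on U (G' i)" for i
    using smooth_U U(1) by (auto simp: f'_def F'_def G'_def C_on_vec_nth)
  have smD: "C_inf_on U (D i g)" "C_inf_on U (Dt g)" if "C_inf_on U g" for g i
    using that by (auto simp: D_def Dt_def intro: C_inf_on_dir_deriv[rule_format])
  have smq: "C_inf_on U q"
    unfolding q_def by (intro C_inf_on_sum U smD sm)
  note diff = C_inf_on_differentiable
  \<comment> \<open>Exchanging two space derivatives removes the divergence of the curl; exchanging
    time and space derivatives gives the equations for the gradient and for
    \<open>q\<close>.\<close>
  have comm: "D i (D j g) p = D j (D i g) p" "Dt (D i g) p = D i (Dt g) p"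
    if "C_inf_on U g" "p \<in> U" for i j g p
    unfolding D_def Dt_def using that by (auto intro: dir_deriv_commute[OF U(1)])

  have diffv: "case_prod f differentiable (at p)" "case_prod F differentiable (at p)"
      "case_prod G differentiable (at p)" if "p \<in> U" for p
    using smooth_U that by (auto intro: diff)
  have grad_U: "grad (f t) x $ i = D i f' (t, x)" if "(t, x) \<in> U" for t x i
    using diffv[OF that] by (simp add: grad_eq_dir_deriv D_def f'_def)
  have div_U: "divergence (F t) x = q (t, x)" if "(t, x) \<in> U" for t x
    using diffv[OF that] by (simp add: divergence_eq_dir_deriv q_def D_def F'_def)
  have curl_U: "curl (G t) x = vector
      [D 2 (G' 3) (t, x) - D 3 (G' 2) (t, x),
       D 3 (G' 1) (t, x) - D 1 (G' 3) (t, x),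
       D 1 (G' 2) (t, x) - D 2 (G' 1) (t, x)]" if "(t, x) \<in> U" for t x
    using diffv[OF that] by (simp add: curl_def Let_def jacobian_eq_dir_deriv D_def G'_def)

  \<comment> \<open>The components of the curl of \<open>G\<close> as space-time functions, indexed
    so that their divergence is a sum over \<open>UNIV\<close>; the last branch is index 3.\<close>
  define w where "w = (\<lambda>i::3. if i = 1 then (\<lambda>p. D 2 (G' 3) p - D 3 (G' 2) p)
      else if i = 2 then (\<lambda>p. D 3 (G' 1) p - D 1 (G' 3) p)
      else (\<lambda>p. D 1 (G' 2) p - D 2 (G' 1) p))"
  have curl_w: "curl (G t) x $ i = w i (t, x)" if "(t, x) \<in> U" for t x i
    using exhaust_3[of i] by (auto simp: curl_U[OF that] w_def vector_3)
  have diff_w: "w i differentiable (at p)" if "p \<in> U" for i p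
    using that by (auto simp: w_def intro!: derivative_intros diff[OF smD(1)] sm)
  have D_diff: "D i (\<lambda>p. g p - h p) p = D i g p - D i h p"
    if "C_inf_on U g" "C_inf_on U h" "p \<in> U" for i g h p
    unfolding D_def using that
    by (intro dir_deriv_eqI has_derivative_diff has_derivative_dir_deriv diff)
  \<comment> \<open>The six mixed second derivatives cancel in pairs by symmetry.\<close>
  have div_curl: "(\<Sum>i\<in>UNIV. D i (w i) p) = 0" if "p \<in> U" for p
    using that by (simp add: sum_3 w_def D_diff smD sm comm(1)[OF sm(3)])

  \<comment> \<open>Evolution equations for the gradient of \<open>f\<close> and the divergence of
    \<open>F\<close>\<close>
  have eq1: "Dt f' (t, x) = - c * q (t, x)" if "t \<in> {0..t\<^sub>f}" "x \<in> \<Omega>" for t x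
    using eq_f[OF that] diffv[OF UI[OF that]]
    by (simp add: time_deriv_eq_dir_deriv div_U[OF UI[OF that]] Dt_def f'_def)
  have eq2: "Dt (F' i) (t, x) = - c * D i f' (t, x) - d * w i (t, x) - r * F' i (t, x)"
    if "t \<in> {0..t\<^sub>f}" "x \<in> \<Omega>" for t x i
  proof -
    have "time_deriv F t x $ i = Dt (F' i) (t, x)"
      using diffv[OF UI[OF that]]
      by (simp add: time_deriv_eq_dir_deriv Dt_def F'_def dir_deriv_vec_nth)
    moreover have "(time_deriv F t x + c *\<^sub>R grad (f t) x + d *\<^sub>R curl (G t) x) $ i
        = (- (r *\<^sub>R F t x)) $ i"
      using eq_F[OF that] by simp
    ultimately show ?thesis
      by (simp add: grad_U[OF UI[OF that]] curl_w[OF UI[OF that]] F'_def)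
  qed

  have eq1': "Dt (D i f') (t, x) = - c * D i q (t, x)" if "t \<in> {0..t\<^sub>f}" "x \<in> \<Omega>" for t x i
  proof -
    have U': "(t, x) \<in> U" by (rule UI[OF that])
    \<comment> \<open>\<open>eq1\<close> is differentiated in space at the fixed time
      \<open>t\<close>, which the openness of \<Omega> permits also at the two end times.\<close>
    have "D i (Dt f') (t, x) = D i (\<lambda>p. - c * q p) (t, x)"
      unfolding D_def
      by (rule dir_deriv_cong_slice[OF \<Omega>(1) that(2)])
        (use U' eq1 that in \<open>auto intro!: derivative_intros diff[OF smq] diff[OF smD(2)] sm\<close>)
    also have "\<dots> = - c * D i q (t, x)"
      using dir_deriv_scaleR[OF diff[OF smq U'], of _ "- c"] by (simp add: D_def)
    finally show ?thesis using comm(2)[OF sm(1) U'] by simp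
  qed
  have eq2': "Dt q (t, x) = - c * (\<Sum>i\<in>UNIV. D i (D i f') (t, x)) - r * q (t, x)"
    if "t \<in> {0..t\<^sub>f}" "x \<in> \<Omega>" for t x
  proof -
    have U': "(t, x) \<in> U" by (rule UI[OF that])
    have "Dt q (t, x) = (\<Sum>i\<in>UNIV. Dt (D i (F' i)) (t, x))"
      unfolding q_def Dt_def by (intro dir_deriv_sum diff[OF smD(1)] sm U')
    also have "\<dots> = (\<Sum>i\<in>UNIV. D i (Dt (F' i)) (t, x))"
      by (simp add: comm(2)[OF sm(2) U'])
    also have "\<dots> = (\<Sum>i\<in>UNIV. D i (\<lambda>p. - c * D i f' p - d * w i p - r * F' i p) (t, x))"
      unfolding D_def
      by (intro sum.cong refl dir_deriv_cong_slice[OF \<Omega>(1) that(2)])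
        (use U' that in \<open>auto simp flip: D_def simp: eq2
          intro!: derivative_intros diff_w diff[OF smD(1)] diff[OF smD(2)] diff[OF sm(2)] sm\<close>)
    also have "\<dots> = (\<Sum>i\<in>UNIV. - c * D i (D i f') (t, x) - d * D i (w i) (t, x)
        - r * D i (F' i) (t, x))"
      unfolding D_def
      by (intro sum.cong refl dir_deriv_eqI has_derivative_diff has_derivative_mult_right
          has_derivative_dir_deriv)
        (use U' in \<open>auto simp flip: D_def intro!: diff_w diff[OF smD(1)] diff[OF sm(2)] sm\<close>)
    \<comment> \<open>The curl terms add up to \<open>- d\<close> times the sum in
      \<open>div_curl\<close>, which is zero.\<close>
    also have "\<dots> = - c * (\<Sum>i\<in>UNIV. D i (D i f') (t, x)) - r * q (t, x)"
      using div_curl[OF U'] by (simp add: q_def sum_subtractf sum_distrib_left[symmetric] sum_negf)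
    finally show ?thesis .
  qed

  \<comment> \<open>Energy density and its time derivative\<close>
  define E E' where "E p = 1 / 2 * ((\<Sum>i\<in>UNIV. (D i f' p)\<^sup>2) + (q p)\<^sup>2)"
    and "E' p = (\<Sum>i\<in>UNIV. D i f' p * Dt (D i f') p) + q p * Dt q p" for p
  have energy_E: "energy \<Omega> f F t = (LINT x:\<Omega>|lborel. E (t, x))" if "t \<in> {0..t\<^sub>f}" for t
    unfolding energy_def E_def using \<Omega>_borel that
    by (intro set_lebesgue_integral_cong) (auto simp: norm_squared_vec grad_U[OF UI] div_U[OF UI])
  have cont: "continuous_on U E" "continuous_on U E'" "continuous_on U (\<lambda>p. (q p)\<^sup>2)"
    unfolding E_def E'_def
    by (intro continuous_intros C_inf_on_continuous smD smq sm)+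
  have int: "set_integrable lborel \<Omega> (\<lambda>x. g (t, x))"
    if "continuous_on U g" "t \<in> {0..t\<^sub>f}" for g :: "real \<times> (real^3) \<Rightarrow> real" and t
    by (intro set_integrable_bounded_continuous \<Omega> \<Omega>_borel continuous_on_compose2[OF that(1)]
        continuous_intros) (use U(2) that in auto)
  \<comment> \<open>The chain rule turns the squares into the products in \<open>E'\<close>, the
    factor 2 cancelling the \<open>1 / 2\<close>. The end times lie inside the open set
    \<open>U\<close>, so the derivative exists there too.\<close>
  have deriv_E: "((\<lambda>s. E (s, x)) has_vector_derivative E' (t, x)) (at t within {a..b})"
    if "t \<in> {a..b}" "x \<in> \<Omega>" for t x
  proof -
    have U': "(t, x) \<in> U" using that ab by (intro UI) auto
    have *: "((\<lambda>s. g (s, x)) has_field_derivative Dt g (t, x)) (at t within {a..b})"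
      if "C_inf_on U g" for g
      unfolding has_real_derivative_iff_has_vector_derivative Dt_def
      by (rule has_vector_derivative_slice[OF diff[OF that U']])
    show ?thesis
      unfolding E_def E'_def has_real_derivative_iff_has_vector_derivative[symmetric]
      by (rule derivative_eq_intros * smD sm smq refl)+
        (simp add: sum_distrib_left field_simps flip: sum_divide_distrib)
  qed

  \<comment> \<open>Integral of the flux term\<close>
  have flux: "(LINT x:\<Omega>|lborel. E' (t, x)) = - r * (LINT x:\<Omega>|lborel. (divergence (F t) x)\<^sup>2)"
    if t: "t \<in> {0..t\<^sub>f}" for t
  proof -
    define V where "V = {x. (t, x) \<in> U}"
    \<comment> \<open>The energy flux, chosen so that \<open>\<Phi> x \<bullet> n x\<close> is the
      integrand of the boundary condition. On \<open>V\<close> its components are the space-time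
      functions \<open>P i\<close>.\<close>
    define \<Phi> where "\<Phi> x = (c * divergence (F t) x) *\<^sub>R grad (f t) x" for x
    define P where "P i p = c * q p * D i f' p" for i p
    have V: "open V" "closure \<Omega> \<subseteq> V"
      using U(2) t
        open_vimage[OF U(1) continuous_on_Pair[OF continuous_on_const continuous_on_id], of t]
      by (auto simp: V_def vimage_def)
    have smP: "C_inf_on U (P i)" for i
      unfolding P_def using smq smD(1)[OF sm(1)] by (auto intro!: C_on_mult U C_on_const)
    have \<Phi>_eq: "\<Phi> x = (\<chi> i. P i (t, x))" if "x \<in> V" for x
      using that by (simp add: \<Phi>_def P_def V_def vec_eq_iff grad_U div_U)
    have "C_on 1 V (\<lambda>x. \<chi> i. P i (t, x))"
      unfolding V_def using smP by (intro C_on_1_slice_vec_lambda U) auto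
    then have C1: "C_on 1 V \<Phi>"
      by (rule C_on_cong[OF V(1), rotated]) (simp add: \<Phi>_eq)
    have "(LINT x:\<Omega>|lborel. divergence \<Phi> x) = (LINT x:frontier \<Omega>|surface_measure. \<Phi> x \<bullet> n x)"
      using domain V C1 unfolding divergence_domain_def by blast
    also have "\<dots> = 0" using boundary[OF t] by (simp add: \<Phi>_def)
    finally have zero: "(LINT x:\<Omega>|lborel. divergence \<Phi> x) = 0" .

    \<comment> \<open>By the product rule the divergence of \<open>\<Phi>\<close> is
      \<open>c\<close> times the sum of \<open>q\<close> times the Laplacian of \<open>f\<close> and
      the inner product of the gradients of \<open>q\<close> and \<open>f\<close>. With
      \<open>eq1'\<close> and \<open>eq2'\<close> these are the terms of \<open>E'\<close> with
      opposite sign, up to the relaxation term.\<close>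
    have div_\<Phi>: "E' (t, x) = - r * (q (t, x))\<^sup>2 - divergence \<Phi> x" if x: "x \<in> \<Omega>" for x
    proof -
      have U': "(t, x) \<in> U" and xV: "x \<in> V" using UI[OF t x] by (auto simp: V_def)
      have "dir_deriv v \<Phi> x $ i = dir_deriv (0, v) (P i) (t, x)" for v i
      proof -
        have dP: "\<Phi> differentiable (at x)" using C1 xV by (simp add: C_on_Suc_dir_deriv)
        have "dir_deriv v \<Phi> x $ i = dir_deriv v (\<lambda>y. \<Phi> y $ i) x"
          using dir_deriv_vec_nth[OF dP] by simp
        also have "\<dots> = dir_deriv v (\<lambda>y. P i (t, y)) x"
          using has_derivative_slice[OF diff[OF smP U']]
          by (intro dir_deriv_cong_open[OF V(1) xV]) (auto simp: \<Phi>_eq differentiable_def)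
        finally show ?thesis using dir_deriv_slice[OF diff[OF smP U']] by simp
      qed
      then have "divergence \<Phi> x = (\<Sum>i\<in>UNIV. D i (P i) (t, x))"
        by (simp add: divergence_def trace_def jacobian_def matrix_def dir_deriv_def D_def)
      also have "\<dots> = (\<Sum>i\<in>UNIV.
          c * q (t, x) * D i (D i f') (t, x) + c * D i q (t, x) * D i f' (t, x))"
        unfolding P_def D_def
        by (intro sum.cong refl dir_deriv_eqI has_derivative_mult has_derivative_mult_right
            has_derivative_dir_deriv)
          (use U' in \<open>auto simp flip: D_def intro!: diff[OF smD(1)] diff[OF smq] sm\<close>)
      finally show ?thesis
        unfolding E'_def eq1'[OF t x] eq2'[OF t x]
        by (simp add: sum_distrib_left sum.distrib algebra_simps power2_eq_square sum_negf)
    qed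
    have int2: "set_integrable lborel \<Omega> (\<lambda>x. - r * (q (t, x))\<^sup>2)"
      by (intro set_integrable_mult_right int[OF cont(3) t])
    \<comment> \<open>Solving \<open>div_\<Phi>\<close> for the divergence writes it as a difference
      of two integrable functions, so the integral below may be split.\<close>
    have "set_integrable lborel \<Omega> (\<lambda>x. - r * (q (t, x))\<^sup>2 - E' (t, x))"
      using int[OF cont(2) t] int2 by (rule set_integral_diff(1)[rotated])
    then have int3: "set_integrable lborel \<Omega> (divergence \<Phi>)"
      by (rule set_integrable_cong[THEN iffD1, rotated 3]) (auto simp: div_\<Phi>)
    have "(LINT x:\<Omega>|lborel. E' (t, x)) = (LINT x:\<Omega>|lborel. - r * (q (t, x))\<^sup>2 - divergence \<Phi> x)"
      using \<Omega>_borel div_\<Phi> by (intro set_lebesgue_integral_cong) auto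
    also have "\<dots> = (LINT x:\<Omega>|lborel. - r * (q (t, x))\<^sup>2)"
      using int2 int3 zero by (simp add: set_integral_diff)
    also have "\<dots> = - r * (LINT x:\<Omega>|lborel. (q (t, x))\<^sup>2)" by (rule set_integral_mult_right)
    also have "(LINT x:\<Omega>|lborel. (q (t, x))\<^sup>2) = (LINT x:\<Omega>|lborel. (divergence (F t) x)\<^sup>2)"
      using \<Omega>_borel by (intro set_lebesgue_integral_cong) (auto simp: div_U UI[OF t])
    finally show ?thesis .
  qed

  have "energy \<Omega> f F b - energy \<Omega> f F a
      = (LINT x:\<Omega>|lborel. E (b, x)) - (LINT x:\<Omega>|lborel. E (a, x))"
    using ab by (simp add: energy_E)
  also have "\<dots> = (LINT s:{a..b}|lborel. LINT x:\<Omega>|lborel. E' (s, x))"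
    by (intro set_integral_time_derivative ab \<Omega> \<Omega>_borel deriv_E int cont)
      (use ab U(2) in \<open>auto intro!: continuous_on_subset[OF cont(2)]\<close>)
  also have "\<dots> = (LINT s:{a..b}|lborel. - r * (LINT x:\<Omega>|lborel. (divergence (F s) x)\<^sup>2))"
    using ab by (intro set_lebesgue_integral_cong) (auto simp: flux)
  also have "\<dots> = - r * (LINT s:{a..b}|lborel. (LINT x:\<Omega>|lborel. (divergence (F s) x)\<^sup>2))"
    by (rule set_integral_mult_right)
  finally show ?thesis .
qed

text \<open>The energy is also nonnegative, hence zero, and its density is continuous and
  nonnegative, so it vanishes pointwise. An upper bound is assumed because that is what dissipation
  supplies.\<close>

lemma energy_nonpos_imp_zero:
  assumes "open \<Omega>" "bounded \<Omega>" "smooth_field t\<^sub>f \<Omega> f" "smooth_field t\<^sub>f \<Omega> F" "t \<in> {0..t\<^sub>f}"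
    and "energy \<Omega> f F t \<le> 0" "x \<in> \<Omega>"
  shows "grad (f t) x = 0 \<and> divergence (F t) x = 0"
proof -
  let ?e = "\<lambda>x. 1 / 2 * ((norm (grad (f t) x))\<^sup>2 + (divergence (F t) x)\<^sup>2)"
  have cont: "continuous_on (closure \<Omega>) ?e"
    by (intro continuous_intros continuous_on_grad[OF assms(3,5)]
        continuous_on_divergence[OF assms(4,5)])
  have "energy \<Omega> f F t \<ge> 0"
    unfolding energy_def set_lebesgue_integral_def by (intro integral_nonneg_AE) auto
  then have zero: "(LINT x:\<Omega>|lborel. ?e x) = 0" using assms(6) unfolding energy_def by linarith
  have int: "set_integrable lborel \<Omega> ?e"
    using assms(1,2) cont by (intro set_integrable_bounded_continuous) auto
  have "continuous_on \<Omega> ?e"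
    using cont closure_subset by (rule continuous_on_subset)
  then have "?e x = 0"
    by (rule set_integral_zero_imp_zero_on_open[OF assms(1) _ _ int zero assms(7)]) simp
  then show ?thesis by (simp add: sum_power2_eq_zero_iff)
qed

lemma energy_eq_zero:
  assumes "\<And>x. x \<in> \<Omega> \<Longrightarrow> grad (f t) x = 0 \<and> divergence (F t) x = 0"
  shows "energy \<Omega> f F t = 0"
  unfolding energy_def set_lebesgue_integral_def
  by (intro integral_eq_zero_AE AE_I2) (auto simp: assms indicator_def)

text \<open>Both pairs of unknowns are instances of \<open>energy_balance\<close>. A nonnegative
  energy that starts at zero and does not increase stays zero, and its density vanishes with
  it.\<close>

theorem mainTheorem6:
  fixes \<Omega> :: "(real^3) set" and n :: "real^3 \<Rightarrow> real^3"
    and t\<^sub>f c\<^sub>0 c\<^sub>h :: real and \<tau> :: ereal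
    and T \<phi> :: "real \<Rightarrow> real^3 \<Rightarrow> real" and J \<psi> :: "real \<Rightarrow> real^3 \<Rightarrow> real^3"
  assumes domain: "divergence_domain \<Omega> n"
    and tf: "t\<^sub>f > 0"
    and tau: "\<tau> > 0"
    and smooth: "smooth_field t\<^sub>f \<Omega> T" "smooth_field t\<^sub>f \<Omega> J"
      "smooth_field t\<^sub>f \<Omega> \<psi>" "smooth_field t\<^sub>f \<Omega> \<phi>"
    and eq_T: "\<And>t x. t \<in> {0..t\<^sub>f} \<Longrightarrow> x \<in> \<Omega> \<Longrightarrow>
      time_deriv T t x + c\<^sub>0 * divergence (J t) x = 0"
    and eq_J: "\<And>t x. t \<in> {0..t\<^sub>f} \<Longrightarrow> x \<in> \<Omega> \<Longrightarrow>
      time_deriv J t x + c\<^sub>0 *\<^sub>R grad (T t) x + c\<^sub>h *\<^sub>R curl (\<psi> t) x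
        = - (real_of_ereal (1 / \<tau>) *\<^sub>R J t x)"
    and eq_psi: "\<And>t x. t \<in> {0..t\<^sub>f} \<Longrightarrow> x \<in> \<Omega> \<Longrightarrow>
      time_deriv \<psi> t x - c\<^sub>h *\<^sub>R curl (J t) x + c\<^sub>h *\<^sub>R grad (\<phi> t) x = 0"
    and eq_phi: "\<And>t x. t \<in> {0..t\<^sub>f} \<Longrightarrow> x \<in> \<Omega> \<Longrightarrow>
      time_deriv \<phi> t x + c\<^sub>h * divergence (\<psi> t) x = 0"
    and boundary_T: "\<And>t. t \<in> {0..t\<^sub>f} \<Longrightarrow>
      (LINT x:frontier \<Omega>|surface_measure.
         c\<^sub>0 * divergence (J t) x * (grad (T t) x \<bullet> n x)) = 0"
    and boundary_phi: "\<And>t. t \<in> {0..t\<^sub>f} \<Longrightarrow>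
      (LINT x:frontier \<Omega>|surface_measure.
         c\<^sub>h * divergence (\<psi> t) x * (grad (\<phi> t) x \<bullet> n x)) = 0"
  shows
    "(\<forall>t\<in>{0..t\<^sub>f}.
        energy \<Omega> T J t - energy \<Omega> T J 0
          = - real_of_ereal (1 / \<tau>) *
              (LINT s:{0..t}|lborel. (LINT x:\<Omega>|lborel. (divergence (J s) x)\<^sup>2))
        \<and> - real_of_ereal (1 / \<tau>) *
              (LINT s:{0..t}|lborel. (LINT x:\<Omega>|lborel. (divergence (J s) x)\<^sup>2)) \<le> 0
        \<and> energy \<Omega> \<phi> \<psi> t - energy \<Omega> \<phi> \<psi> 0 = 0)
     \<and> (\<tau> < \<infinity> \<longrightarrow>
          antimono_on {0..t\<^sub>f} (energy \<Omega> T J) \<and> energy \<Omega> \<phi> \<psi> constant_on {0..t\<^sub>f})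
     \<and> (\<tau> = \<infinity> \<longrightarrow>
          energy \<Omega> T J constant_on {0..t\<^sub>f} \<and> energy \<Omega> \<phi> \<psi> constant_on {0..t\<^sub>f})
     \<and> ((\<forall>x\<in>\<Omega>. grad (T 0) x = 0 \<and> divergence (J 0) x = 0) \<longrightarrow>
          (\<forall>t\<in>{0<..t\<^sub>f}. \<forall>x\<in>\<Omega>. grad (T t) x = 0 \<and> divergence (J t) x = 0))
     \<and> ((\<forall>x\<in>\<Omega>. grad (\<phi> 0) x = 0 \<and> divergence (\<psi> 0) x = 0) \<longrightarrow>
          (\<forall>t\<in>{0<..t\<^sub>f}. \<forall>x\<in>\<Omega>. grad (\<phi> t) x = 0 \<and> divergence (\<psi> t) x = 0))"
proof -
  \<comment> \<open>In the extended reals \<open>1 / \<infinity>\<close> is \<open>0\<close>, so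
    \<open>r\<close> is the usual reciprocal for finite \<open>\<tau>\<close> and switches the
    relaxation off for \<open>\<tau> = \<infinity>\<close>.\<close>
  define r where "r = real_of_ereal (1 / \<tau>)"
  have r: "r \<ge> 0" "\<tau> = \<infinity> \<Longrightarrow> r = 0"
    using tau by (auto simp: r_def real_of_ereal_pos)
  have \<Omega>: "open \<Omega>" "bounded \<Omega>" using domain by (auto simp: divergence_domain_def)
  define dissipation where "dissipation a b
    = (LINT s:{a..b}|lborel. (LINT x:\<Omega>|lborel. (divergence (J s) x)\<^sup>2))" for a b
  \<comment> \<open>The sign of the integrand decides at both levels, since a Bochner integral that
    does not exist has the value 0.\<close>
  have diss_nonneg: "dissipation a b \<ge> 0" for a b
    unfolding dissipation_def set_lebesgue_integral_def
    by (intro integral_nonneg_AE AE_I2) (auto intro!: integral_nonneg_AE)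
  have bal_T: "energy \<Omega> T J b - energy \<Omega> T J a = - r * dissipation a b"
    if "0 \<le> a" "a \<le> b" "b \<le> t\<^sub>f" for a b
    unfolding dissipation_def r_def
    by (rule energy_balance[OF domain smooth(1,2,3) eq_T eq_J boundary_T that])
  \<comment> \<open>The equation for \<open>\<psi>\<close> in the form of
    \<open>energy_balance\<close>: \<open>J\<close> enters through its curl with coupling
    \<open>- c\<^sub>h\<close>, and the relaxation rate is 0.\<close>
  have eq_psi': "time_deriv \<psi> t x + c\<^sub>h *\<^sub>R grad (\<phi> t) x + (- c\<^sub>h) *\<^sub>R curl (J t) x = - (0 *\<^sub>R \<psi> t x)"
    if "t \<in> {0..t\<^sub>f}" "x \<in> \<Omega>" for t x
    using eq_psi[OF that] by (simp add: algebra_simps)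
  have bal_phi: "energy \<Omega> \<phi> \<psi> b = energy \<Omega> \<phi> \<psi> a" if "0 \<le> a" "a \<le> b" "b \<le> t\<^sub>f" for a b
    using energy_balance[OF domain smooth(4,3,2) eq_phi eq_psi' boundary_phi that] by simp
  have const_phi: "energy \<Omega> \<phi> \<psi> t = energy \<Omega> \<phi> \<psi> 0" if "t \<in> {0..t\<^sub>f}" for t
    using that by (intro bal_phi) auto
  have diss_T: "- r * dissipation a b \<le> 0" for a b
    using r diss_nonneg[of a b] by simp
  have "energy \<Omega> T J b \<le> energy \<Omega> T J a" if "0 \<le> a" "a \<le> b" "b \<le> t\<^sub>f" for a b
    using bal_T[OF that] diss_T[of a b] by simp
  then have mono_T: "antimono_on {0..t\<^sub>f} (energy \<Omega> T J)"
    by (intro monotone_onI) auto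
  have const_T: "energy \<Omega> T J constant_on {0..t\<^sub>f}" if "\<tau> = \<infinity>"
    unfolding constant_on_def
  proof (intro exI ballI)
    show "energy \<Omega> T J t = energy \<Omega> T J 0" if "t \<in> {0..t\<^sub>f}" for t
      using bal_T[of 0 t] that r(2)[OF \<open>\<tau> = \<infinity>\<close>] by simp
  qed
  have zero_T: "grad (T t) x = 0 \<and> divergence (J t) x = 0"
    if "\<forall>x\<in>\<Omega>. grad (T 0) x = 0 \<and> divergence (J 0) x = 0" "t \<in> {0<..t\<^sub>f}" "x \<in> \<Omega>" for t x
  proof (rule energy_nonpos_imp_zero[OF \<Omega> smooth(1,2)])
    \<comment> \<open>The balance from time 0 bounds the energy by its initial value, which is zero
      for vanishing initial data.\<close>
    show "energy \<Omega> T J t \<le> 0"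
      using bal_T[of 0 t] diss_T[of 0 t] energy_eq_zero[of \<Omega> T 0 J] that by simp
  qed (use that in auto)
  have zero_phi: "grad (\<phi> t) x = 0 \<and> divergence (\<psi> t) x = 0"
    if "\<forall>x\<in>\<Omega>. grad (\<phi> 0) x = 0 \<and> divergence (\<psi> 0) x = 0" "t \<in> {0<..t\<^sub>f}" "x \<in> \<Omega>" for t x
  proof (rule energy_nonpos_imp_zero[OF \<Omega> smooth(4,3)])
    show "energy \<Omega> \<phi> \<psi> t \<le> 0"
      using const_phi[of t] energy_eq_zero[of \<Omega> \<phi> 0 \<psi>] that by simp
  qed (use that in auto)
  have bal_T0: "energy \<Omega> T J t - energy \<Omega> T J 0 = - r * dissipation 0 t" if "t \<in> {0..t\<^sub>f}" for t
    using that by (intro bal_T) auto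
  have diff_phi: "energy \<Omega> \<phi> \<psi> t - energy \<Omega> \<phi> \<psi> 0 = 0" if "t \<in> {0..t\<^sub>f}" for t
    using const_phi[OF that] by simp
  have const_phi': "energy \<Omega> \<phi> \<psi> constant_on {0..t\<^sub>f}"
    using const_phi unfolding constant_on_def by blast
  show ?thesis
    unfolding r_def[symmetric] dissipation_def[symmetric]
    using zero_T zero_phi
    by (intro conjI impI ballI bal_T0 diss_T const_phi' mono_T const_T diff_phi) blast+
qed

end
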